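(* Let $N\ge 1$ and let $f\in C_0(\mathbb{R}^N)$. For $m>2$ let $\lambda_m$ be the generalized principal eigenvalue of $$\lambda-\Delta u+\frac1m|Du|^m=f\ \text{ in }\mathbb{R}^N,\qquad u(0)=0,$$ and let $\lambda_\infty$ be the generalized principal eigenvalue of $$\max\{\lambda-\Delta u-f,\ |Du|-1\}=0\ \text{ in }\mathbb{R}^N,\qquad u(0)=0.\qquad(\ast)$$ Then $\lambda_m\to\lambda_\infty$ as $m\to\infty$. Moreover, $(\ast)$ with $\lambda=\lambda_\infty$ has a viscosity solution $u\in C^{0,1}(\mathbb{R}^N)$.
   Context: $C_0(\mathbb{R}^N)$ is the set of continuous $f:\mathbb{R}^N\to\mathbb{R}$ with $f(x)\to0$ as $|x|\to\infty$. $C^{0,\gamma}(\mathbb{R}^N)$, $\gamma\in(0,1]$, denotes the space of locally Hölder (Lipschitz if $\gamma=1$) functions, i.e. functions that are $\gamma$-Hölder on every ball $B_R$ centered at the origin, with constant possibly depending on $R$. Solutions and subsolutions are in the usual viscosity sense unless stated otherwise. For $m>2$ put $\alpha:=(m-2)/(m-1)$; $\lambda_m$ is the supremum of all $\lambda\in\mathbb{R}$ such that $\lambda-\Delta u+\frac1m|Du|^m=f$ in $\mathbb{R}^N$, $u(0)=0$, has a viscosity subsolution $u\in C^{0,\alpha}(\mathbb{R}^N)$. $\lambda_\infty$ is the supremum of all $\lambda\in\mathbb{R}$ such that $\max\{\lambda-\Delta u-f,|Du|-1\}=0$ in $\mathbb{R}^N$, $u(0)=0$, has a viscosity subsolution $u\in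 C^{0,1}(\mathbb{R}^N)$. *)

theory Defs
  imports "HOL-Analysis.Analysis"
begin

section \<open>Function spaces\<close>

definition C0_space :: "(real^'n \<Rightarrow> real) set" where
  "C0_space = {f. continuous_on UNIV f \<and> (f \<longlongrightarrow> 0) at_infinity}"

definition loc_Holder :: "real \<Rightarrow> (real^'n \<Rightarrow> real) set" where
  "loc_Holder \<gamma> = {u. \<forall>R>0. \<exists>C. \<forall>x\<in>ball 0 R. \<forall>y\<in>ball 0 R.
     \<bar>u x - u y\<bar> \<le> C * (dist x y) powr \<gamma>}"

section \<open>Viscosity solutions\<close>

definition grad :: "(real^'n \<Rightarrow> real) \<Rightarrow> real^'n \<Rightarrow> real^'n" where
  "grad \<phi> x = (THE D. GDERIV \<phi> x :> D)"

definition hess :: "(real^'n \<Rightarrow> real) \<Rightarrow> real^'n \<Rightarrow> real^'n^'n" where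
  "hess \<phi> x = jacobian (grad \<phi>) (at x)"

definition C2_functions :: "(real^'n \<Rightarrow> real) set" where
  "C2_functions = {\<phi>. (\<forall>x. \<phi> differentiable (at x)) \<and>
     (\<forall>x. grad \<phi> differentiable (at x)) \<and> continuous_on UNIV (hess \<phi>)}"

definition usc :: "(real^'n \<Rightarrow> real) \<Rightarrow> bool" where
  "usc u \<longleftrightarrow> (\<forall>x. \<forall>c>u x. \<forall>\<^sub>F y in nhds x. u y < c)"

definition lsc :: "(real^'n \<Rightarrow> real) \<Rightarrow> bool" where
  "lsc u \<longleftrightarrow> (\<forall>x. \<forall>c<u x. \<forall>\<^sub>F y in nhds x. c < u y)"

(* An operator F x p X stands for the equation F(x, Du, D^2 u) = 0 in R^N,
   with F nonincreasing in the symmetric matrix X. *)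

definition viscosity_subsolution ::
  "(real^'n \<Rightarrow> real^'n \<Rightarrow> real^'n^'n \<Rightarrow> real) \<Rightarrow> (real^'n \<Rightarrow> real) \<Rightarrow> bool" where
  "viscosity_subsolution F u \<longleftrightarrow> usc u \<and>
     (\<forall>\<phi>\<in>C2_functions. \<forall>x. (\<forall>\<^sub>F y in nhds x. u y - \<phi> y \<le> u x - \<phi> x)
        \<longrightarrow> F x (grad \<phi> x) (hess \<phi> x) \<le> 0)"

definition viscosity_supersolution ::
  "(real^'n \<Rightarrow> real^'n \<Rightarrow> real^'n^'n \<Rightarrow> real) \<Rightarrow> (real^'n \<Rightarrow> real) \<Rightarrow> bool" where
  "viscosity_supersolution F u \<longleftrightarrow> lsc u \<and>
     (\<forall>\<phi>\<in>C2_functions. \<forall>x. (\<forall>\<^sub>F y in nhds x. u x - \<phi> x \<le> u y - \<phi> y)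
        \<longrightarrow> 0 \<le> F x (grad \<phi> x) (hess \<phi> x))"

definition viscosity_solution ::
  "(real^'n \<Rightarrow> real^'n \<Rightarrow> real^'n^'n \<Rightarrow> real) \<Rightarrow> (real^'n \<Rightarrow> real) \<Rightarrow> bool" where
  "viscosity_solution F u \<longleftrightarrow> viscosity_subsolution F u \<and> viscosity_supersolution F u"

section \<open>The two equations and their generalized principal eigenvalues\<close>

(* The Laplacian is the trace of the Hessian. *)

definition op_m :: "real \<Rightarrow> (real^'n \<Rightarrow> real) \<Rightarrow> real \<Rightarrow>
    real^'n \<Rightarrow> real^'n \<Rightarrow> real^'n^'n \<Rightarrow> real" where
  "op_m m f l x p X = l - trace X + (1 / m) * norm p powr m - f x"

definition op_infty :: "(real^'n \<Rightarrow> real) \<Rightarrow> real \<Rightarrow>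
    real^'n \<Rightarrow> real^'n \<Rightarrow> real^'n^'n \<Rightarrow> real" where
  "op_infty f l x p X = max (l - trace X - f x) (norm p - 1)"

(* The suprema are taken in the extended reals, since the real Sup is unspecified
   on sets that are empty or unbounded above. *)

definition lambda_m :: "real \<Rightarrow> (real^'n \<Rightarrow> real) \<Rightarrow> ereal" where
  "lambda_m m f = Sup (ereal ` {l. \<exists>u \<in> loc_Holder ((m - 2) / (m - 1)).
     u 0 = 0 \<and> viscosity_subsolution (op_m m f l) u})"

definition lambda_infty :: "(real^'n \<Rightarrow> real) \<Rightarrow> ereal" where
  "lambda_infty f = Sup (ereal ` {l. \<exists>u \<in> loc_Holder 1.
     u 0 = 0 \<and> viscosity_subsolution (op_infty f l) u})"

end

theory Submission
  imports Defs "HOL-Real_Asymp.Real_Asymp"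
begin

text \<open>
  No comparison principle is needed. Continuous subsolutions of the constrained equation are
  1-Lipschitz, so they are subsolutions of the \<open>m\<close>-equation up to an error \<open>1/m\<close>. Conversely, a
  barrier with infinite slope at the centre and at the boundary of a unit ball bounds the modulus
  of continuity of the subsolutions of the \<open>m\<close>-equation uniformly in large \<open>m\<close>; their cluster points
  are subsolutions of the constrained equation.

  For the existence of a solution, let \<open>w\<^sub>n\<close> be subsolutions for \<open>l\<^sub>n \<rightarrow> \<lambda>\<^sub>\<infinity>\<close> and let \<open>v\<^sub>n \<ge> w\<^sub>n\<close> be the
  maximal subsolution of the equation with \<open>l\<^sub>n\<close> replaced by \<open>l\<^sub>n + (v - w\<^sub>n) / n\<close>. By Perron's method it is a
  solution, and \<open>(v\<^sub>n - w\<^sub>n) / n\<close> is nonnegative and bounded, with a constant limit \<open>c \<ge> 0\<close>. Then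
  \<open>v\<^sub>n - v\<^sub>n(0)\<close> converges to a solution for \<open>\<lambda>\<^sub>\<infinity> + c\<close>, and \<open>c = 0\<close> by the definition of \<open>\<lambda>\<^sub>\<infinity>\<close>.
\<close>

section \<open>Calculus of test functions\<close>

text \<open>Two obstacles shape the estimates for the \<open>m\<close>-equation. The Hoelder
  constants may depend on \<open>m\<close>, and nothing bounds u on a sphere uniformly, so boundary
  maxima must be excluded by the slope of the barrier alone: near the sphere it grows like the
  square root of the distance, and for m > 3 the Hoelder exponent exceeds 1/2. At the centre a cone
  would fail in dimension N > 1, since its Laplacian blows up while its gradient stays bounded; the
  square root of the distance has a gradient that blows up too, and its \<open>m\<close>-th power
  then beats the Laplacian. The undiscounted equation is invariant under adding constants, so
  Perron's supremum would be infinite, and a normalization at 0 would not survive a local lifting.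
  The discount bounds the family from above. It is measured from \<open>w\<^sub>n\<close> because
  \<open>v\<^sub>n\<close> and \<open>w\<^sub>n\<close> are both 1-Lipschitz: their difference
  varies by at most 2|x| between 0 and x, so the discount flattens to a constant in the limit even
  if both functions grow linearly.\<close>

lemma gderiv_unique:
  assumes "GDERIV \<phi> x :> D" "GDERIV \<phi> x :> E"
  shows "D = E"
proof -
  have "(\<lambda>h. h \<bullet> D) = (\<lambda>h. h \<bullet> E)"
    using assms has_derivative_unique unfolding gderiv_def by blast
  then have "(D - E) \<bullet> (D - E) = 0"
    by (metis inner_diff_right right_minus_eq)
  then show ?thesis by simp
qed

lemma grad_eqI: "GDERIV \<phi> x :> D \<Longrightarrow> grad \<phi> x = D"
  unfolding grad_def by (rule the_equality) (auto intro: gderiv_unique)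

text \<open>Since \<open>grad\<close> is a description and \<open>hess\<close> is built on it,
  explicit candidates are supplied for all points at once; uniqueness of derivatives then identifies
  both as functions, as the continuity of the Hessian requires.\<close>

lemma C2_functionsI:
  assumes "\<And>x. GDERIV \<phi> x :> D x"
    and "\<And>x. (D has_derivative (\<lambda>v. H x *v v)) (at x)"
    and "continuous_on UNIV H"
  shows "\<phi> \<in> C2_functions" "grad \<phi> x = D x" "hess \<phi> x = H x"
proof -
  have g: "grad \<phi> = D"
    using grad_eqI[OF assms(1)] by blast
  have "hess \<phi> x = H x" for x
    unfolding hess_def g jacobian_def frechet_derivative_at[OF assms(2), symmetric] by simp
  then have h: "hess \<phi> = H" by blast
  show "\<phi> \<in> C2_functions"
    unfolding C2_functions_def mem_Collect_eq g h
    using assms(1)[unfolded gderiv_def] assms(2,3) by (auto simp: differentiable_def)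
  show "grad \<phi> x = D x" "hess \<phi> x = H x" by (simp_all add: g h)
qed

lemma C2_gderiv:
  assumes "\<phi> \<in> C2_functions"
  shows "GDERIV \<phi> x :> grad \<phi> x"
proof -
  obtain \<phi>' where d: "(\<phi> has_derivative \<phi>') (at x)"
    using assms unfolding C2_functions_def differentiable_def by blast
  interpret bounded_linear \<phi>' using d by (rule has_derivative_bounded_linear)
  have "\<phi>' = (\<lambda>h. h \<bullet> (\<Sum>i\<in>Basis. \<phi>' i *\<^sub>R i))"
  proof
    fix h
    have "\<phi>' h = \<phi>' (\<Sum>i\<in>Basis. (h \<bullet> i) *\<^sub>R i)" by (simp add: euclidean_representation)
    also have "\<dots> = h \<bullet> (\<Sum>i\<in>Basis. \<phi>' i *\<^sub>R i)"
      by (simp add: sum scaleR inner_sum_right mult.commute)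
    finally show "\<phi>' h = h \<bullet> (\<Sum>i\<in>Basis. \<phi>' i *\<^sub>R i)" .
  qed
  then have "GDERIV \<phi> x :> (\<Sum>i\<in>Basis. \<phi>' i *\<^sub>R i)"
    using d unfolding gderiv_def by simp
  then show ?thesis using grad_eqI by metis
qed

lemma C2_hess_derivative:
  assumes "\<phi> \<in> C2_functions"
  shows "(grad \<phi> has_derivative (\<lambda>v. hess \<phi> x *v v)) (at x)"
  using assms unfolding C2_functions_def hess_def by (simp add: jacobian_works)

lemma C2_hess_continuous: "\<phi> \<in> C2_functions \<Longrightarrow> continuous_on UNIV (hess \<phi>)"
  unfolding C2_functions_def by simp

lemma C2_grad_continuous: "\<phi> \<in> C2_functions \<Longrightarrow> continuous_on UNIV (grad \<phi>)"
  by (auto intro!: continuous_at_imp_continuous_on has_derivative_continuous C2_hess_derivative)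

lemma C2_continuous: "\<phi> \<in> C2_functions \<Longrightarrow> continuous_on UNIV \<phi>"
  using C2_gderiv unfolding gderiv_def
  by (auto intro!: continuous_at_imp_continuous_on has_derivative_continuous)

lemma trace_add: "trace (A + B) = trace A + trace (B :: real^'n^'n)"
  by (simp add: trace_def sum.distrib)

lemma trace_uminus: "trace (- A) = - trace (A :: real^'n^'n)"
  by (simp add: trace_def sum_negf)

lemma continuous_on_trace [continuous_intros]:
  "continuous_on S A \<Longrightarrow> continuous_on S (\<lambda>x. trace (A x :: real^'n^'n))"
  unfolding trace_def by (intro continuous_intros)

lemma C2_add:
  assumes "\<phi> \<in> C2_functions" "\<psi> \<in> C2_functions"
  shows "(\<lambda>x. \<phi> x + \<psi> x) \<in> C2_functions"
    and "grad (\<lambda>x. \<phi> x + \<psi> x) x = grad \<phi> x + grad \<psi> x"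
    and "hess (\<lambda>x. \<phi> x + \<psi> x) x = hess \<phi> x + hess \<psi> x"
proof -
  have 1: "GDERIV (\<lambda>x. \<phi> x + \<psi> x) x :> grad \<phi> x + grad \<psi> x" for x
    using assms by (intro GDERIV_add C2_gderiv)
  have 2: "((\<lambda>x. grad \<phi> x + grad \<psi> x) has_derivative (\<lambda>v. (hess \<phi> x + hess \<psi> x) *v v)) (at x)" for x
    unfolding matrix_vector_mult_add_rdistrib using assms by (intro has_derivative_add C2_hess_derivative)
  have 3: "continuous_on UNIV (\<lambda>x. hess \<phi> x + hess \<psi> x)"
    using assms by (intro continuous_intros C2_hess_continuous)
  show "(\<lambda>x. \<phi> x + \<psi> x) \<in> C2_functions"
    "grad (\<lambda>x. \<phi> x + \<psi> x) x = grad \<phi> x + grad \<psi> x"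
    "hess (\<lambda>x. \<phi> x + \<psi> x) x = hess \<phi> x + hess \<psi> x"
    by (rule C2_functionsI[OF 1 2 3])+
qed

lemma matrix_vector_mult_uminus: "(- A) *v v = - (A *v (v :: real^'n))"
  by (vector matrix_vector_mult_def sum_negf)

lemma C2_uminus:
  assumes "\<phi> \<in> C2_functions"
  shows "(\<lambda>x. - \<phi> x) \<in> C2_functions"
    and "grad (\<lambda>x. - \<phi> x) x = - grad \<phi> x"
    and "hess (\<lambda>x. - \<phi> x) x = - hess \<phi> x"
proof -
  have 1: "GDERIV (\<lambda>x. - \<phi> x) x :> - grad \<phi> x" for x
    using assms by (intro GDERIV_minus C2_gderiv)
  have 2: "((\<lambda>x. - grad \<phi> x) has_derivative (\<lambda>v. (- hess \<phi> x) *v v)) (at x)" for x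
    unfolding matrix_vector_mult_uminus using assms by (intro has_derivative_minus C2_hess_derivative)
  have 3: "continuous_on UNIV (\<lambda>x. - hess \<phi> x)"
    using assms by (intro continuous_intros C2_hess_continuous)
  show "(\<lambda>x. - \<phi> x) \<in> C2_functions"
    "grad (\<lambda>x. - \<phi> x) x = - grad \<phi> x"
    "hess (\<lambda>x. - \<phi> x) x = - hess \<phi> x"
    by (rule C2_functionsI[OF 1 2 3])+
qed

lemma C2_diff:
  assumes "\<phi> \<in> C2_functions" "\<psi> \<in> C2_functions"
  shows "(\<lambda>x. \<phi> x - \<psi> x) \<in> C2_functions"
    and "grad (\<lambda>x. \<phi> x - \<psi> x) x = grad \<phi> x - grad \<psi> x"
    and "hess (\<lambda>x. \<phi> x - \<psi> x) x = hess \<phi> x - hess \<psi> x"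
  using C2_add(1)[OF assms(1) C2_uminus(1)[OF assms(2)]]
    C2_add(2,3)[OF assms(1) C2_uminus(1)[OF assms(2)], of x] C2_uminus(2,3)[OF assms(2), of x]
  by simp_all

lemma trace_diff: "trace (A - B) = trace A - trace (B :: real^'n^'n)"
  by (simp add: trace_def sum_subtractf)

text \<open>Up to a constant, the second-order Taylor polynomial at s = \<open>c\<close>, in the
  variable s = |y - x0|^2, of a profile with derivatives \<open>a\<close> and \<open>2 * b\<close>
  there. Being polynomial in y it is C2 on the whole space. It also supplies |y - x|^4 and |y - x|^2
  / 2.\<close>

definition radial_quartic :: "real^'n \<Rightarrow> real \<Rightarrow> real \<Rightarrow> real \<Rightarrow> real^'n \<Rightarrow> real" where
  "radial_quartic x0 a b c y = a * (norm (y - x0))\<^sup>2 + b * ((norm (y - x0))\<^sup>2 - c)\<^sup>2"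

lemma radial_quartic_C2:
  fixes x0 :: "real^'n"
  shows "radial_quartic x0 a b c \<in> C2_functions" (is ?A)
    and "grad (radial_quartic x0 a b c) y = (2 * a + 4 * b * ((norm (y - x0))\<^sup>2 - c)) *\<^sub>R (y - x0)" (is ?B)
    and "trace (hess (radial_quartic x0 a b c) y) =
      real CARD('n) * (2 * a + 4 * b * ((norm (y - x0))\<^sup>2 - c)) + 8 * b * (norm (y - x0))\<^sup>2" (is ?C)
proof -
  define k where "k y = 2 * a + 4 * b * ((norm (y - x0))\<^sup>2 - c)" for y
  define D where "D y = k y *\<^sub>R (y - x0)" for y
  define H :: "real^'n \<Rightarrow> real^'n^'n"
    where "H y = (\<chi> i j. (if i = j then k y else 0) + 8 * b * (y - x0) $ i * (y - x0) $ j)" for y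
  have eq: "radial_quartic x0 a b c = (\<lambda>y. a * ((y - x0) \<bullet> (y - x0)) + b * ((y - x0) \<bullet> (y - x0) - c)\<^sup>2)"
    unfolding radial_quartic_def by (simp add: power2_norm_eq_inner)
  have 1: "GDERIV (radial_quartic x0 a b c) y :> D y" for y
    unfolding gderiv_def eq D_def k_def
    by (rule derivative_eq_intros refl | force simp: algebra_simps inner_commute power2_norm_eq_inner)+
  have H: "H y *v v = k y *\<^sub>R v + (8 * b * ((y - x0) \<bullet> v)) *\<^sub>R (y - x0)" for y v
  proof -
    have "(\<Sum>j\<in>UNIV. ((if i = j then k y else 0) + 8 * b * (y - x0) $ i * (y - x0) $ j) * v $ j)
        = k y * v $ i + 8 * b * ((y - x0) \<bullet> v) * (y - x0) $ i" for i
    proof -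
      have "(\<Sum>j\<in>UNIV. ((if i = j then k y else 0) + 8 * b * (y - x0) $ i * (y - x0) $ j) * v $ j)
          = (\<Sum>j\<in>UNIV. (if i = j then k y * v $ j else 0) + (8 * b * (y - x0) $ i) * ((y - x0) $ j * v $ j))"
        by (intro sum.cong refl) (simp add: distrib_right mult.assoc)
      also have "\<dots> = k y * v $ i + (8 * b * (y - x0) $ i) * ((y - x0) \<bullet> v)"
        unfolding sum.distrib sum_distrib_left[symmetric] by (simp add: inner_vec_def)
      finally show ?thesis by (simp only: mult_ac)
    qed
    then show ?thesis unfolding H_def by (simp add: vec_eq_iff matrix_vector_mult_def)
  qed
  have 2: "(D has_derivative (\<lambda>v. H y *v v)) (at y)" for y
    unfolding H D_def k_def power2_norm_eq_inner
    by (rule derivative_eq_intros refl | force simp: algebra_simps inner_commute)+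
  have 3: "continuous_on UNIV H"
    unfolding H_def k_def
  proof (intro continuous_on_vec_lambda continuous_on_add)
    have "continuous_on UNIV (\<lambda>y. 2 * a + 4 * b * ((norm (y - x0))\<^sup>2 - c))"
      by (intro continuous_intros)
    then show "continuous_on UNIV (\<lambda>y. if i = j then 2 * a + 4 * b * ((norm (y - x0))\<^sup>2 - c) else 0)" for i j :: 'n
      by (cases "i = j") simp_all
  qed (intro continuous_intros)
  show ?A by (rule C2_functionsI(1)[OF 1 2 3])
  show ?B using C2_functionsI(2)[OF 1 2 3, of y] unfolding D_def k_def .
  have "trace (H y) = (\<Sum>i\<in>UNIV. k y + 8 * b * ((y - x0) $ i * (y - x0) $ i))"
    by (simp add: H_def trace_def mult.assoc)
  also have "\<dots> = real CARD('n) * k y + 8 * b * (norm (y - x0))\<^sup>2"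
    by (simp add: sum.distrib power2_norm_eq_inner inner_vec_def sum_distrib_left)
  finally show ?C unfolding C2_functionsI(3)[OF 1 2 3, of y] k_def .
qed

text \<open>The derivative \<open>e1\<close> changes sign from negative to positive at
  \<open>t0\<close>, so \<open>e\<close> is strictly monotone on either side.\<close>

lemma second_derivative_test:
  fixes e :: "real \<Rightarrow> real"
  assumes d1: "\<forall>\<^sub>F t in nhds t0. (e has_real_derivative e1 t) (at t)"
    and "e1 t0 = 0" and d2: "(e1 has_real_derivative e2) (at t0)" and "e2 > 0"
  shows "\<forall>\<^sub>F t in at t0. e t0 < e t"
proof -
  obtain r where r: "r > 0" "\<And>t. \<bar>t - t0\<bar> < r \<Longrightarrow> (e has_real_derivative e1 t) (at t)"
    using d1 unfolding eventually_nhds_metric dist_real_def by blast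
  obtain r1 where r1: "r1 > 0" "\<And>h. 0 < h \<Longrightarrow> h < r1 \<Longrightarrow> 0 < e1 (t0 + h)"
    using DERIV_pos_inc_right[OF d2 \<open>e2 > 0\<close>] \<open>e1 t0 = 0\<close> by force
  obtain r2 where r2: "r2 > 0" "\<And>h. 0 < h \<Longrightarrow> h < r2 \<Longrightarrow> e1 (t0 - h) < 0"
    using DERIV_pos_inc_left[OF d2 \<open>e2 > 0\<close>] \<open>e1 t0 = 0\<close> by force
  define s where "s = min r (min r1 r2)"
  have "e t0 < e t" if t: "t \<noteq> t0" "\<bar>t - t0\<bar> < s" for t
  proof (cases "t > t0")
    case True
    have cont: "continuous_on {t0..t} e"
      using t True by (intro continuous_at_imp_continuous_on ballI DERIV_isCont[OF r(2)]) (auto simp: s_def)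
    show ?thesis
    proof (rule DERIV_pos_imp_increasing_open[OF True _ cont])
      fix x assume x: "t0 < x" "x < t"
      then show "\<exists>y. (e has_real_derivative y) (at x) \<and> 0 < y"
        using r(2)[of x] r1(2)[of "x - t0"] t True by (auto simp: s_def)
    qed
  next
    case False
    then have lt: "t < t0" using t by simp
    have cont: "continuous_on {t..t0} e"
      using t lt by (intro continuous_at_imp_continuous_on ballI DERIV_isCont[OF r(2)]) (auto simp: s_def)
    show ?thesis
    proof (rule DERIV_neg_imp_decreasing_open[OF lt _ cont])
      fix x assume x: "t < x" "x < t0"
      then show "\<exists>y. (e has_real_derivative y) (at x) \<and> y < 0"
        using r(2)[of x] r2(2)[of "t0 - x"] t lt by (auto simp: s_def)
    qed
  qed
  moreover have "s > 0" using r r1 r2 by (simp add: s_def)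
  ultimately show ?thesis unfolding eventually_at dist_real_def by blast
qed

text \<open>Restriction to coordinate lines reaches the diagonal of the Hessian, which is all that
  the Laplacian sees: a positive entry would make x a strict local minimum along its line.\<close>

lemma C2_local_max:
  fixes \<phi> :: "real^'n \<Rightarrow> real"
  assumes C2: "\<phi> \<in> C2_functions" and max: "\<forall>\<^sub>F y in nhds x. \<phi> y \<le> \<phi> x"
  shows "grad \<phi> x = 0" "trace (hess \<phi> x) \<le> 0"
proof -
  obtain r where r: "r > 0" "\<And>y. dist y x < r \<Longrightarrow> \<phi> y \<le> \<phi> x"
    using max unfolding eventually_nhds_metric by blast
  have "(\<lambda>h. h \<bullet> grad \<phi> x) = (\<lambda>h. 0)"
    using C2_gderiv[OF C2, of x] r unfolding gderiv_def
    by (intro differential_zero_maxmin[of x "ball x r" \<phi>]) (auto simp: dist_commute)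
  then have "grad \<phi> x \<bullet> grad \<phi> x = 0" by metis
  then show g: "grad \<phi> x = 0" by simp
  have "hess \<phi> x $ i $ i \<le> 0" for i
  proof (rule ccontr)
    assume pos: "\<not> hess \<phi> x $ i $ i \<le> 0"
    let ?v = "axis i 1 :: real^'n"
    define l where "l t = x + t *\<^sub>R ?v" for t
    have l: "(l has_derivative (\<lambda>h. h *\<^sub>R ?v)) (at t)" for t
      unfolding l_def by (auto intro!: derivative_eq_intros)
    have d1: "((\<lambda>t. - \<phi> (l t)) has_real_derivative - (grad \<phi> (l t) \<bullet> ?v)) (at t)" for t
      using has_derivative_compose[OF l C2_gderiv[OF C2, unfolded gderiv_def], of t]
      by (intro DERIV_minus) (simp add: has_field_derivative_def inner_commute mult_commute_abs)
    have "((\<lambda>t. grad \<phi> (l t) \<bullet> ?v) has_derivative (\<lambda>h. (hess \<phi> (l 0) *v (h *\<^sub>R ?v)) \<bullet> ?v)) (at 0)"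
      by (intro has_derivative_inner_left has_derivative_compose[OF l C2_hess_derivative[OF C2]])
    moreover have "(hess \<phi> (l 0) *v (h *\<^sub>R ?v)) \<bullet> ?v = h * (hess \<phi> x $ i $ i)" for h
      by (simp add: l_def matrix_vector_mult_scaleR inner_axis matrix_vector_mult_basis column_def)
    ultimately have d2: "((\<lambda>t. grad \<phi> (l t) \<bullet> ?v) has_real_derivative hess \<phi> x $ i $ i) (at 0)"
      by (simp add: has_field_derivative_def mult_commute_abs)
    have "\<forall>\<^sub>F t in at 0. - (- \<phi> (l 0)) < - (- \<phi> (l t))"
      using second_derivative_test[where e="\<lambda>t. \<phi> (l t)" and ?e1.0="\<lambda>t. grad \<phi> (l t) \<bullet> ?v", OF _ _ d2]
        DERIV_minus[OF d1] pos g by (auto simp: l_def)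
    moreover have "(\<lambda>t. l t) \<midarrow>0\<rightarrow> x"
      unfolding l_def by (auto intro!: tendsto_eq_intros)
    then have "\<forall>\<^sub>F t in at 0. \<phi> (l t) \<le> \<phi> x"
      using max unfolding filterlim_iff by blast
    ultimately have "\<forall>\<^sub>F t::real in at 0. False"
      by eventually_elim (simp add: l_def)
    then show False by simp
  qed
  then show "trace (hess \<phi> x) \<le> 0" unfolding trace_def by (intro sum_nonpos)
qed

text \<open>A profile such as the square root is not C2 at the centre, so \<open>g\<close> itself
  need not give a global test function. Near the contact value, its Taylor polynomial with second
  derivative raised by \<open>e\<close> lies above \<open>g\<close> up to a constant and still
  touches u from above; \<open>e\<close> is the price paid in the Laplacian.\<close>

lemma radial_touching:
  fixes u :: "real^'n \<Rightarrow> real"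
  defines "s \<equiv> \<lambda>x0 y. (norm (y - x0 :: real^'n))\<^sup>2"
  assumes max: "\<forall>\<^sub>F y in nhds z. u y - g (s x0 y) \<le> u z - g (s x0 z)"
    and g1: "\<forall>\<^sub>F t in nhds (s x0 z). (g has_real_derivative g1 t) (at t)"
    and g2: "(g1 has_real_derivative g2) (at (s x0 z))"
    and "e > 0"
  obtains \<phi> where "\<phi> \<in> C2_functions" "\<forall>\<^sub>F y in nhds z. u y - \<phi> y \<le> u z - \<phi> z"
    "grad \<phi> z = (2 * g1 (s x0 z)) *\<^sub>R (z - x0)"
    "trace (hess \<phi> z) = 2 * real CARD('n) * g1 (s x0 z) + 4 * s x0 z * (g2 + e)"
proof
  let ?a = "g1 (s x0 z)" and ?b = "(g2 + e) / 2"
  let ?\<phi> = "radial_quartic x0 ?a ?b (s x0 z)"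
  show "?\<phi> \<in> C2_functions" by (rule radial_quartic_C2)
  show "grad ?\<phi> z = (2 * g1 (s x0 z)) *\<^sub>R (z - x0)"
    by (simp add: radial_quartic_C2 s_def)
  show "trace (hess ?\<phi> z) = 2 * real CARD('n) * g1 (s x0 z) + 4 * s x0 z * (g2 + e)"
    by (simp add: radial_quartic_C2 s_def)
  define E where "E t = ?a * t + ?b * (t - s x0 z)\<^sup>2 - g t" for t
  define E1 where "E1 t = ?a + 2 * ?b * (t - s x0 z) - g1 t" for t
  have d1: "\<forall>\<^sub>F t in nhds (s x0 z). (E has_real_derivative E1 t) (at t)"
    using g1 by eventually_elim (auto simp: E_def[abs_def] E1_def field_simps intro!: derivative_eq_intros)
  have d2: "(E1 has_real_derivative e) (at (s x0 z))"
    unfolding E1_def[abs_def] using g2 by (auto simp: add_divide_distrib intro!: derivative_eq_intros)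
  have "\<forall>\<^sub>F t in at (s x0 z). E (s x0 z) < E t"
    using second_derivative_test[OF d1 _ d2 \<open>e > 0\<close>] by (simp add: E1_def)
  then have min: "\<forall>\<^sub>F t in nhds (s x0 z). E (s x0 z) \<le> E t"
    unfolding eventually_at_filter by eventually_elim force
  have "filterlim (s x0) (nhds (s x0 z)) (nhds z)"
    unfolding s_def by (intro tendsto_intros filterlim_ident)
  with min have "\<forall>\<^sub>F y in nhds z. E (s x0 z) \<le> E (s x0 y)"
    unfolding filterlim_iff by blast
  with max show "\<forall>\<^sub>F y in nhds z. u y - ?\<phi> y \<le> u z - ?\<phi> z"
    by eventually_elim (simp add: radial_quartic_def E_def s_def)
qed

lemma radial_comparison:
  fixes u :: "real^'n \<Rightarrow> real"
  assumes cu: "continuous_on (cball x0 R) u" and cg: "continuous_on {0..R\<^sup>2} g" and "R > 0"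
    and bd: "\<And>z. dist x0 z = R \<Longrightarrow>
        \<exists>y\<in>cball x0 R. u z - g (R\<^sup>2) < u y - g ((norm (y - x0))\<^sup>2)"
    and int: "\<And>z. z \<noteq> x0 \<Longrightarrow> dist x0 z < R \<Longrightarrow>
        \<not> (\<forall>\<^sub>F y in nhds z. u y - g ((norm (y - x0))\<^sup>2) \<le> u z - g ((norm (z - x0))\<^sup>2))"
    and y: "y \<in> cball x0 R"
  shows "u y - u x0 \<le> g ((norm (y - x0))\<^sup>2) - g 0"
proof -
  define \<phi> where "\<phi> y = g ((norm (y - x0))\<^sup>2)" for y
  have nn: "norm (y - x0) = dist x0 y" for y by (simp add: dist_norm norm_minus_commute)
  have "continuous_on (cball x0 R) \<phi>" unfolding \<phi>_def
    by (rule continuous_on_compose2[OF cg]) (auto intro!: continuous_intros power_mono simp: nn)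
  then have "continuous_on (cball x0 R) (\<lambda>y. u y - \<phi> y)" using cu by (intro continuous_intros)
  moreover have "cball x0 R \<noteq> {}" using \<open>R > 0\<close> by simp
  ultimately obtain z where z: "z \<in> cball x0 R" "\<And>y. y \<in> cball x0 R \<Longrightarrow> u y - \<phi> y \<le> u z - \<phi> z"
    using continuous_attains_sup[OF compact_cball, of x0 R "\<lambda>y. u y - \<phi> y"] by blast
  have "dist x0 z \<noteq> R" using bd[of z] z(2) unfolding \<phi>_def nn by fastforce
  then have "z \<in> ball x0 R" using z(1) by simp
  then have "\<forall>\<^sub>F y in nhds z. y \<in> ball x0 R" by (intro eventually_nhds_in_open) auto
  then have "\<forall>\<^sub>F y in nhds z. u y - \<phi> y \<le> u z - \<phi> z"
    by eventually_elim (simp add: z(2))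
  then have "z = x0" using int[of z] \<open>z \<in> ball x0 R\<close> unfolding \<phi>_def by auto
  then show ?thesis using z(2)[OF y] by (simp add: \<phi>_def)
qed

section \<open>Moduli of continuity of subsolutions\<close>

text \<open>A cone of slope L > 1 violates the gradient constraint away from its vertex. To exclude
  maxima on the sphere it is raised by a multiple of a high power of |y - x0|^2 / R^2, which covers
  the oscillation of u there and disappears at y as the power grows.\<close>

lemma subsolution_infty_le:
  fixes u :: "real^'n \<Rightarrow> real"
  assumes cu: "continuous_on UNIV u" and sub: "viscosity_subsolution (op_infty f l) u" and "L > 1"
  shows "u y - u x0 \<le> L * dist y x0"
proof -
  \<comment> \<open>The added 1 keeps y strictly inside the ball, so the powers used at the end tend
    to 0.\<close>
  define R where "R = dist y x0 + 1"
  have R: "R > 0" by (simp add: R_def add.commute add_strict_increasing)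
  have "compact (u ` cball x0 R)"
    using cu by (intro compact_continuous_image compact_cball) (auto intro: continuous_on_subset)
  then have "bounded (u ` cball x0 R)" by (rule compact_imp_bounded)
  then obtain B where B: "\<And>z. z \<in> cball x0 R \<Longrightarrow> \<bar>u z\<bar> \<le> B"
    unfolding bounded_iff by (auto simp del: mem_cball)
  define C where "C = 2 * B"
  have C: "u z - u x0 \<le> C" if "z \<in> cball x0 R" for z
    using B[OF that] B[of x0] R by (simp add: C_def)
  have "C \<ge> 0" using C[of x0] R by simp
  have bound: "u y - u x0 \<le> L * dist y x0 + C * ((dist y x0)\<^sup>2 / R\<^sup>2) ^ Suc n" for n
  proof -
    define g where "g t = L * sqrt t + C * (t / R\<^sup>2) ^ Suc n" for t
    define g1 where "g1 t = L * (inverse (sqrt t) / 2) + C * (real (Suc n) * (t / R\<^sup>2) ^ n / R\<^sup>2)" for t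
    have "u y - u x0 \<le> g ((norm (y - x0))\<^sup>2) - g 0"
    proof (rule radial_comparison[OF _ _ R])
      show "continuous_on (cball x0 R) u" using cu continuous_on_subset by blast
      show "continuous_on {0..R\<^sup>2} g" unfolding g_def using R by (intro continuous_intros) auto
      show "y \<in> cball x0 R" by (simp add: R_def dist_commute)
    next
      fix z assume z: "dist x0 z = R"
      have "u z - g (R\<^sup>2) < u x0 - g ((norm (x0 - x0))\<^sup>2)"
        using C[of z] z R \<open>L > 1\<close> by (simp add: g_def)
          (smt (verit) mult_pos_pos)
      then show "\<exists>y\<in>cball x0 R. u z - g (R\<^sup>2) < u y - g ((norm (y - x0))\<^sup>2)"
        using R by (intro bexI[of _ x0]) auto
    next
      fix z assume z: "z \<noteq> x0" "dist x0 z < R"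
      define t where "t = (norm (z - x0))\<^sup>2"
      have t: "t > 0" using z by (simp add: t_def)
      have d1: "(g has_real_derivative g1 t') (at t')" if "t' > 0" for t'
        unfolding g_def[abs_def] g1_def using that R
        by (auto intro!: derivative_eq_intros simp del: power_Suc simp: field_simps) (simp add: algebra_simps)
      have ev: "\<forall>\<^sub>F t' in nhds t. (g has_real_derivative g1 t') (at t')"
        using d1 t by (auto intro!: eventually_mono[OF eventually_nhds_in_open[of "{0<..}" t]])
      \<comment> \<open>The contradiction comes from the gradient alone, so existence of the second
        derivative suffices.\<close>
      have "\<exists>g2. (g1 has_real_derivative g2) (at t)"
        unfolding g1_def[abs_def] using t R
        by (intro exI) (rule derivative_eq_intros refl | force)+
      then obtain g2 where g2: "(g1 has_real_derivative g2) (at t)" ..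
      show "\<not> (\<forall>\<^sub>F y in nhds z. u y - g ((norm (y - x0))\<^sup>2) \<le> u z - g ((norm (z - x0))\<^sup>2))"
      proof
        assume max: "\<forall>\<^sub>F y in nhds z. u y - g ((norm (y - x0))\<^sup>2) \<le> u z - g ((norm (z - x0))\<^sup>2)"
        obtain \<phi> where \<phi>: "\<phi> \<in> C2_functions" "\<forall>\<^sub>F y in nhds z. u y - \<phi> y \<le> u z - \<phi> z"
          "grad \<phi> z = (2 * g1 t) *\<^sub>R (z - x0)"
          using radial_touching[OF max ev[unfolded t_def] g2[unfolded t_def], of 1] by (auto simp: t_def)
        then have "norm (grad \<phi> z) \<le> 1"
          using sub unfolding viscosity_subsolution_def op_infty_def by force
        moreover have "norm (grad \<phi> z) = \<bar>2 * g1 t\<bar> * sqrt t"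
          unfolding \<phi>(3) by (simp add: t_def)
        moreover have "g1 t \<ge> L * (inverse (sqrt t) / 2)"
          using \<open>C \<ge> 0\<close> t by (simp add: g1_def)
        then have "2 * g1 t * sqrt t \<ge> 2 * (L * (inverse (sqrt t) / 2)) * sqrt t"
          using t by (intro mult_right_mono mult_left_mono) auto
        then have "2 * g1 t * sqrt t \<ge> L" using t by (simp add: field_simps)
        moreover have "2 * g1 t * sqrt t \<le> \<bar>2 * g1 t\<bar> * sqrt t"
          using t by (intro mult_right_mono) auto
        ultimately show False using \<open>L > 1\<close> by linarith
      qed
    qed
    then show ?thesis by (simp add: g_def dist_norm)
  qed
  have "(dist y x0)\<^sup>2 < R\<^sup>2" unfolding R_def by (intro power_strict_mono) auto
  then have "\<bar>(dist y x0)\<^sup>2 / R\<^sup>2\<bar> < 1" using R by (simp add: abs_of_nonneg)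
  then have "(\<lambda>n. ((dist y x0)\<^sup>2 / R\<^sup>2) ^ Suc n) \<longlonglongrightarrow> 0"
    by (intro LIMSEQ_Suc LIMSEQ_power_zero) simp
  then have "(\<lambda>n. L * dist y x0 + C * ((dist y x0)\<^sup>2 / R\<^sup>2) ^ Suc n) \<longlonglongrightarrow> L * dist y x0 + C * 0"
    by (intro tendsto_intros)
  then show ?thesis using bound by (intro LIMSEQ_le_const[of _ "L * dist y x0"]) auto
qed

lemma subsolution_infty_1_Lipschitz:
  fixes u :: "real^'n \<Rightarrow> real"
  assumes "continuous_on UNIV u" "viscosity_subsolution (op_infty f l) u"
  shows "\<bar>u x - u y\<bar> \<le> dist x y"
proof -
  have "u a - u b \<le> dist a b" for a b
  proof (rule tendsto_lowerbound)
    show "((\<lambda>L. L * dist a b) \<longlongrightarrow> dist a b) (at_right 1)"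
      by (auto intro!: tendsto_eq_intros)
    show "\<forall>\<^sub>F L in at_right 1. u a - u b \<le> L * dist a b"
      using subsolution_infty_le[OF assms] by (auto simp: eventually_at_filter)
  qed simp
  from this[of x y] this[of y x] show ?thesis by (simp add: dist_commute abs_le_iff)
qed

text \<open>The argument is a squared distance t = s^2, so the profile is 10 (s^(1/2) + 1 - sqrt (1
  - s^2)), which is 0 at the centre. The first term has infinite slope at s = 0, the last at s = 1.
  The factor 10 brings the gradient above twice
  \<open>t powr (-1/4) + (1 - t) powr (-1/2)\<close>.\<close>

definition barrier :: "real \<Rightarrow> real" where
  "barrier t = 10 * (t powr (1/4) + 1 - sqrt (1 - t))"

text \<open>\<open>p\<close> is the gradient norm of the barrier, \<open>g1\<close> and
  \<open>g2\<close> are its derivatives in t. With P = t^(-1/4) + (1 - t)^(-1/2), the left side is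
  at most a constant times P^3, while p >= 2P. As m >= 3 and P >= 1, the right side is at least (2^m
  / m) P^3, so a large m wins uniformly in t.\<close>

lemma barrier_gradient_dominates:
  fixes t m M :: real and N :: nat
  defines "p \<equiv> 2 * (10 * (t powr (-3/4) / 4 + (1 - t) powr (-1/2) / 2)) * sqrt t"
    and "g1 \<equiv> 10 * (t powr (-3/4) / 4 + (1 - t) powr (-1/2) / 2)"
    and "g2 \<equiv> 10 * ((1 - t) powr (-3/2) / 4 - 3 * t powr (-7/4) / 16)"
  assumes t: "0 < t" "t < 1" and m: "m \<ge> 3" and "M \<ge> 0"
    and large: "M + 20 * real N + 14 < 2 powr m / m"
  shows "M + 2 * real N * g1 + 4 * t * (g2 + 1) < (1 / m) * p powr m"
proof -
  define a where "a = t powr (-1/4)"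
  define b where "b = (1 - t) powr (-1/2)"
  have a3: "t powr (-3/4) = a ^ 3"
    using t by (simp add: a_def powr_powr flip: powr_realpow)
  have b3: "(1 - t) powr (-3/2) = b ^ 3"
    using t by (simp add: b_def powr_powr flip: powr_realpow)
  have a1: "a \<ge> 1" using powr_mono'[of "-1/4" 0 t] t by (simp add: a_def)
  have b1: "b \<ge> 1" using powr_mono'[of "-1/2" 0 "1 - t"] t by (simp add: b_def)
  have sa: "a ^ 3 * sqrt t = a"
    using t by (simp add: a_def powr_half_sqrt[symmetric] powr_powr flip: powr_realpow powr_add)
  have bs: "b = 1 / sqrt (1 - t)"
    using t by (simp add: b_def powr_minus_divide powr_half_sqrt)
  define P where "P = a + b"
  have P1: "P \<ge> 1" using a1 b1 by (simp add: P_def)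
  define c where "c = sqrt t * b"
  have p_eq: "p = 5 * a + 10 * c"
    unfolding p_def a3 b_def[symmetric] c_def using sa by (simp add: algebra_simps)
  \<comment> \<open>For t >= 1/25 the bound sqrt t >= 1/5 turns \<open>10 * c\<close> into at least
    \<open>2 * b\<close>. Closer to the centre b <= 3/2, and the surplus \<open>3 * a\<close>, at
    least 3, covers \<open>2 * b\<close>.\<close>
  have p: "p \<ge> 2 * P"
  proof (cases "t \<ge> 1 / 25")
    case True
    then have "sqrt t \<ge> 1 / 5"
      by (intro real_le_rsqrt) (simp add: power2_eq_square)
    then have "c \<ge> 1 / 5 * b"
      unfolding c_def using b1 by (intro mult_right_mono) auto
    then show ?thesis using a1 by (auto simp: p_eq P_def)
  next
    case False
    then have "sqrt (1 - t) \<ge> 2 / 3"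
      by (intro real_le_rsqrt) (simp add: power2_eq_square)
    then have "b \<le> 1 / (2 / 3)" unfolding bs using t by (intro divide_left_mono) auto
    moreover have "c \<ge> 0" using t b1 by (simp add: c_def)
    ultimately show ?thesis using a1 by (auto simp: p_eq P_def)
  qed
  have aP: "a ^ 3 \<le> P ^ 3" and bP: "b ^ 3 \<le> P ^ 3"
    using a1 b1 by (auto simp: P_def intro!: power_mono)
  have PP: "1 \<le> P ^ 3" using P1 by simp
  have "b \<le> b ^ 3" using b1 by (simp add: self_le_power)
  then have "a ^ 3 / 4 + b / 2 \<le> P ^ 3" using aP bP PP by simp
  then have "g1 \<le> 10 * P ^ 3" unfolding g1_def a3 b_def[symmetric] by simp
  then have 1: "2 * real N * g1 \<le> 2 * real N * (10 * P ^ 3)" by (intro mult_left_mono) auto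
  have "g2 \<le> 10 * (b ^ 3 / 4)" unfolding g2_def b3 by (intro mult_left_mono) auto
  then have "g2 \<le> 10 * P ^ 3 / 4" using bP by simp
  then have "4 * t * (g2 + 1) \<le> 4 * t * (10 * P ^ 3 / 4 + 1)" using t by (intro mult_left_mono) auto
  also have "\<dots> \<le> 4 * 1 * (10 * P ^ 3 / 4 + 1)" using t P1 by (intro mult_right_mono mult_left_mono) auto
  finally have 2: "4 * t * (g2 + 1) \<le> 10 * P ^ 3 + 4" by simp
  have 3: "M + 4 \<le> (M + 4) * P ^ 3" using PP \<open>M \<ge> 0\<close> by simp
  \<comment> \<open>Origin of the constants in \<open>large\<close>: 20 N comes from the term with
    \<open>g1\<close>, and 14 = 10 + 4 from the term with \<open>g2\<close>.\<close>
  have "M + 2 * real N * g1 + 4 * t * (g2 + 1) \<le> (M + 20 * real N + 14) * P ^ 3"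
    using 1 2 3 by (simp add: algebra_simps)
  also have "\<dots> < (2 powr m / m) * P ^ 3" using large P1 by (intro mult_strict_right_mono) auto
  also have "\<dots> \<le> (2 powr m / m) * P powr m"
    using P1 m powr_mono[of 3 m P] by (intro mult_left_mono) auto
  also have "\<dots> = (1 / m) * (2 * P) powr m" using P1 by (simp add: powr_mult)
  also have "\<dots> \<le> (1 / m) * p powr m" using p P1 m by (intro mult_left_mono powr_mono2) auto
  finally show ?thesis .
qed

section \<open>Hoelder regularity and the modulus uniform in m\<close>

lemma loc_HolderE:
  assumes "u \<in> loc_Holder \<gamma>" "R > 0"
  obtains C where "\<And>x y. norm x < R \<Longrightarrow> norm y < R \<Longrightarrow> \<bar>u x - u y\<bar> \<le> C * dist x y powr \<gamma>"
proof -
  from assms obtain C where "\<forall>x\<in>ball 0 R. \<forall>y\<in>ball 0 R. \<bar>u x - u y\<bar> \<le> C * dist x y powr \<gamma>"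
    unfolding loc_Holder_def by blast
  then show thesis by (intro that[of C]) auto
qed

text \<open>Near the boundary of the unit ball the barrier grows like a square root of the distance, which
  beats any Hoelder function of exponent above one half; this excludes boundary maxima.\<close>

lemma barrier_boundary:
  fixes u :: "real^'n \<Rightarrow> real"
  assumes u: "u \<in> loc_Holder \<gamma>" and "\<gamma> > 1/2" and z: "dist x0 z = 1"
  shows "\<exists>y\<in>cball x0 1. u z - barrier 1 < u y - barrier ((norm (y - x0))\<^sup>2)"
proof (rule ccontr)
  assume "\<not> ?thesis"
  then have max: "u y - barrier ((norm (y - x0))\<^sup>2) \<le> u z - barrier 1" if "dist x0 y \<le> 1" for y
    using that by force
  have "norm x0 + 2 > 0" by (simp add: add_nonneg_pos)
  then obtain C where C: "\<And>x y. norm x < norm x0 + 2 \<Longrightarrow> norm y < norm x0 + 2 \<Longrightarrow>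
      \<bar>u x - u y\<bar> \<le> C * dist x y powr \<gamma>"
    using loc_HolderE[OF u] by metis
  \<comment> \<open>Moving inwards from z by \<tau> along the radius lowers the barrier by at least
    10 sqrt \<tau>, while u changes by at most C times the power \<gamma> of \<tau>.\<close>
  have *: "10 \<le> \<bar>C\<bar> * \<tau> powr (\<gamma> - 1/2)" if \<tau>: "0 < \<tau>" "\<tau> < 1" for \<tau>
  proof -
    define y where "y = x0 + (1 - \<tau>) *\<^sub>R (z - x0)"
    have n1: "norm (z - x0) = 1" using z by (simp add: dist_norm norm_minus_commute)
    have ny: "norm (y - x0) = 1 - \<tau>" using \<tau> n1 by (simp add: y_def)
    have zy: "z - y = \<tau> *\<^sub>R (z - x0)" by (simp add: y_def algebra_simps)
    have d: "dist z y = \<tau>" using n1 \<tau> by (simp add: dist_norm zy)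
    have "norm z < norm x0 + 2" using norm_triangle_ineq[of "z - x0" x0] n1 by simp
    moreover have "norm y < norm x0 + 2" using norm_triangle_ineq[of "y - x0" x0] ny \<tau> by simp
    ultimately have "u z - u y \<le> C * \<tau> powr \<gamma>" using C[of z y] d by simp
    also have "\<dots> \<le> \<bar>C\<bar> * \<tau> powr \<gamma>" by (intro mult_right_mono) auto
    finally have "barrier 1 - barrier ((1 - \<tau>)\<^sup>2) \<le> \<bar>C\<bar> * \<tau> powr \<gamma>"
      using max[of y] ny \<tau> by (simp add: dist_norm norm_minus_commute)
    moreover have "((1 - \<tau>)\<^sup>2) powr (1/4) \<le> 1"
      using \<tau> by (intro powr_le1) (auto simp: power_le_one)
    moreover define r where "r = sqrt (1 - (1 - \<tau>)\<^sup>2)"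
    have "sqrt \<tau> \<le> r"
      using \<tau> by (simp add: r_def power2_eq_square algebra_simps)
    ultimately have "10 * sqrt \<tau> \<le> \<bar>C\<bar> * \<tau> powr \<gamma>"
      by (simp add: barrier_def flip: r_def)
    also have "\<dots> = (\<bar>C\<bar> * \<tau> powr (\<gamma> - 1/2)) * sqrt \<tau>"
      using \<tau> by (simp add: powr_half_sqrt[symmetric] flip: powr_add)
    finally show ?thesis using \<tau> by simp
  qed
  have "((\<lambda>\<tau>::real. \<bar>C\<bar> * \<tau> powr (\<gamma> - 1/2)) \<longlongrightarrow> \<bar>C\<bar> * 0 powr (\<gamma> - 1/2)) (at_right 0)"
    using \<open>\<gamma> > 1/2\<close> by (intro tendsto_intros tendsto_powr') (auto simp: eventually_at_filter)
  moreover have "\<forall>\<^sub>F \<tau> in at_right 0. 10 \<le> \<bar>C\<bar> * \<tau> powr (\<gamma> - 1/2)"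
    using * by (auto simp: eventually_at dist_real_def intro!: exI[of _ 1])
  ultimately have "10 \<le> \<bar>C\<bar> * 0 powr (\<gamma> - 1/2)" by (rule tendsto_lowerbound) simp
  then show False by simp
qed

lemma loc_Holder_continuous:
  fixes u :: "real^'n \<Rightarrow> real"
  assumes u: "u \<in> loc_Holder \<gamma>" and "\<gamma> > 0"
  shows "continuous_on UNIV u"
proof (intro continuous_at_imp_continuous_on ballI)
  fix x :: "real^'n"
  have "norm x + 1 > 0" by (simp add: add_nonneg_pos)
  then obtain C where C: "\<And>a b. norm a < norm x + 1 \<Longrightarrow> norm b < norm x + 1 \<Longrightarrow>
      \<bar>u a - u b\<bar> \<le> C * dist a b powr \<gamma>"
    using loc_HolderE[OF u] by metis
  have "\<forall>\<^sub>F y in at x. y \<in> ball 0 (norm x + 1)"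
    by (rule eventually_at_in_open') auto
  then have "\<forall>\<^sub>F y in at x. norm (u y - u x) \<le> C * dist y x powr \<gamma>"
    by eventually_elim (use C in auto)
  moreover have "((\<lambda>y. C * dist y x powr \<gamma>) \<longlongrightarrow> C * dist x x powr \<gamma>) (at x)"
    using \<open>\<gamma> > 0\<close> by (intro tendsto_intros tendsto_powr') auto
  then have "((\<lambda>y. C * dist y x powr \<gamma>) \<longlongrightarrow> 0) (at x)" by simp
  ultimately have "((\<lambda>y. u y - u x) \<longlongrightarrow> 0) (at x)" by (rule Lim_null_comparison)
  then show "isCont u x" unfolding isCont_def using LIM_zero_iff by blast
qed

text \<open>The bound contains neither the Hoelder constant of u nor m; this uniformity supplies the
  compactness as m grows. On the unit ball around x0 the Hoelder exponent excludes boundary maxima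
  and the equation excludes interior ones off the centre.\<close>

lemma subsolution_m_modulus:
  fixes u :: "real^'n \<Rightarrow> real"
  assumes m: "m > 3" and u: "u \<in> loc_Holder ((m - 2) / (m - 1))"
    and sub: "viscosity_subsolution (op_m m f l) u"
    and f: "\<And>x. f x \<le> l + M" and "M \<ge> 0"
    and large: "M + 20 * real CARD('n) + 14 < 2 powr m / m"
    and y: "dist y x0 \<le> 1"
  shows "u y - u x0 \<le> barrier ((dist y x0)\<^sup>2)"
proof -
  \<comment> \<open>This is exactly the condition m > 3.\<close>
  have \<gamma>: "(m - 2) / (m - 1) > 1/2" using m by (simp add: field_simps)
  have cu: "continuous_on UNIV u" using \<gamma> by (intro loc_Holder_continuous[OF u]) linarith
  have "u y - u x0 \<le> barrier ((norm (y - x0))\<^sup>2) - barrier 0"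
  proof (rule radial_comparison[where R=1])
    show "continuous_on (cball x0 1) u" using cu continuous_on_subset by blast
    show "continuous_on {0..1\<^sup>2} barrier"
      unfolding barrier_def by (intro continuous_intros continuous_on_powr') auto
    show "y \<in> cball x0 1" using y by (simp add: dist_commute)
  next
    fix z assume z: "dist x0 z = 1"
    show "\<exists>y\<in>cball x0 1. u z - barrier (1\<^sup>2) < u y - barrier ((norm (y - x0))\<^sup>2)"
      using barrier_boundary[OF u \<gamma> z] by simp
  next
    fix z assume z: "z \<noteq> x0" "dist x0 z < 1"
    define t where "t = (norm (z - x0))\<^sup>2"
    have nz: "norm (z - x0) < 1" using z by (simp add: dist_norm norm_minus_commute)
    have t: "0 < t" "t < 1" using z nz by (auto simp: t_def power_less_one_iff abs_square_less_1)
    define g1 :: "real \<Rightarrow> real" where "g1 t = 10 * (t powr (-3/4) / 4 + (1 - t) powr (-1/2) / 2)" for t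
    define g2 where "g2 = 10 * ((1 - t) powr (-3/2) / 4 - 3 * t powr (-7/4) / 16)"
    have d1: "(barrier has_real_derivative g1 t') (at t')" if "t' \<in> {0<..<1}" for t'
      unfolding barrier_def[abs_def] g1_def using that
      by (auto intro!: derivative_eq_intros simp: powr_half_sqrt[symmetric] powr_minus_divide field_simps)
    have ev: "\<forall>\<^sub>F t' in nhds t. (barrier has_real_derivative g1 t') (at t')"
      using t by (intro eventually_mono[OF eventually_nhds_in_open[of "{0<..<1}" t] d1]) auto
    have d2: "(g1 has_real_derivative g2) (at t)"
      unfolding g1_def[abs_def] g2_def using t
      by (auto intro!: derivative_eq_intros simp: field_simps)
    show "\<not> (\<forall>\<^sub>F y in nhds z. u y - barrier ((norm (y - x0))\<^sup>2) \<le> u z - barrier ((norm (z - x0))\<^sup>2))"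
    proof
      assume max: "\<forall>\<^sub>F y in nhds z. u y - barrier ((norm (y - x0))\<^sup>2) \<le> u z - barrier ((norm (z - x0))\<^sup>2)"
      obtain \<phi> where \<phi>: "\<phi> \<in> C2_functions" "\<forall>\<^sub>F y in nhds z. u y - \<phi> y \<le> u z - \<phi> z"
        "grad \<phi> z = (2 * g1 t) *\<^sub>R (z - x0)"
        "trace (hess \<phi> z) = 2 * real CARD('n) * g1 t + 4 * t * (g2 + 1)"
        using radial_touching[OF max ev[unfolded t_def] d2[unfolded t_def], of 1] by (auto simp: t_def)
      have "g1 t \<ge> 0" using t by (simp add: g1_def)
      then have "norm (grad \<phi> z) = 2 * g1 t * sqrt t" unfolding \<phi>(3) by (simp add: t_def)
      moreover have "l - trace (hess \<phi> z) + (1 / m) * norm (grad \<phi> z) powr m - f z \<le> 0"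
        using sub \<phi>(1,2) unfolding viscosity_subsolution_def op_m_def by blast
      ultimately have "(1 / m) * (2 * g1 t * sqrt t) powr m
          \<le> M + 2 * real CARD('n) * g1 t + 4 * t * (g2 + 1)"
        using f[of z] \<phi>(4) by simp
      then show False
        using barrier_gradient_dominates[OF t _ \<open>M \<ge> 0\<close> large] m unfolding g1_def g2_def by force
    qed
  qed simp
  then show ?thesis by (simp add: dist_norm barrier_def)
qed

section \<open>Stability under limits\<close>

lemma tendsto_nhds_of_continuous:
  fixes h :: "'a::topological_space \<Rightarrow> 'b::topological_space"
  assumes "continuous_on UNIV h"
  shows "(h \<longlongrightarrow> h x) (nhds x)"
  using assms by (simp add: continuous_on_def tendsto_at_iff_tendsto_nhds)

lemma tendsto_snd_nhds:
  fixes h :: "'a::topological_space \<Rightarrow> 'b::topological_space"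
  assumes "continuous_on UNIV h"
  shows "((\<lambda>z. h (snd z)) \<longlongrightarrow> h x) (G \<times>\<^sub>F nhds x)"
  by (rule filterlim_compose[OF tendsto_nhds_of_continuous[OF assms] filterlim_snd])

text \<open>Tychonoff: the functions eventually lie in a product of compact intervals, hence have a
  cluster point, and refining F by its neighbourhoods gives convergence. Filters replace diagonal
  sequences and treat the real parameter m and the index n alike.\<close>

lemma pointwise_cluster:
  fixes w :: "'i \<Rightarrow> 'a \<Rightarrow> real"
  assumes "F \<noteq> bot" and bd: "\<forall>\<^sub>F i in F. \<forall>x. \<bar>w i x\<bar> \<le> b x"
  obtains G u where "G \<le> F" "G \<noteq> bot" "\<And>x. ((\<lambda>i. w i x) \<longlongrightarrow> u x) G"
proof -
  let ?K = "PiE UNIV (\<lambda>x. {- b x..b x})"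
  have "compactin (product_topology (\<lambda>_. euclidean) UNIV) ?K"
    unfolding compactin_PiE by simp
  then have "compact ?K"
    by (simp add: euclidean_product_topology)
  moreover have "filtermap w F \<noteq> bot" using \<open>F \<noteq> bot\<close> by (simp add: filtermap_bot_iff)
  moreover have "\<forall>\<^sub>F v in filtermap w F. v \<in> ?K"
    unfolding eventually_filtermap using bd 
    by eventually_elim (auto simp: PiE_iff abs_le_iff minus_le_iff)
  ultimately obtain u where u: "inf (nhds u) (filtermap w F) \<noteq> bot"
    unfolding compact_filter by blast
  define G where "G = inf (filtercomap w (nhds u)) F"
  \<comment> \<open>A trivial G would mean that w eventually avoids some neighbourhood of u, against
    u being a cluster point.\<close>
  have "G \<noteq> bot"
  proof
    assume "G = bot"
    then have "\<forall>\<^sub>F i in inf (filtercomap w (nhds u)) F. False" by (simp add: G_def)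
    then obtain Q R where Q: "eventually Q (nhds u)" and R: "eventually R F"
        "\<And>i. Q (w i) \<Longrightarrow> R i \<Longrightarrow> False"
      unfolding eventually_inf eventually_filtercomap by blast
    have "\<forall>\<^sub>F v in filtermap w F. \<not> Q v"
      unfolding eventually_filtermap using R(1) by eventually_elim (use R(2) in blast)
    with Q have "\<forall>\<^sub>F v in inf (nhds u) (filtermap w F). False"
      unfolding eventually_inf by blast
    with u show False by simp
  qed
  moreover have "((\<lambda>i. w i x) \<longlongrightarrow> u x) G" for x
  proof -
    have "filterlim w (nhds u) G"
      unfolding G_def by (rule filterlim_mono[OF filterlim_filtercomap order_refl inf_le1])
    then have w: "\<forall>\<^sub>F i in G. w i \<in> S" if "open S" "u \<in> S" for S
      using that eventually_nhds_in_open[of S u] unfolding filterlim_iff by blast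
    show ?thesis
    proof (rule topological_tendstoI)
      fix S assume "open S" "u x \<in> S"
      have "open ((\<lambda>v::'a \<Rightarrow> real. v x) -` S)"
        using \<open>open S\<close> by (rule open_vimage) (rule continuous_on_product_coordinates)
      then show "\<forall>\<^sub>F i in G. w i x \<in> S" using w[of "(\<lambda>v. v x) -` S"] \<open>u x \<in> S\<close> by simp
    qed
  qed
  moreover have "G \<le> F" by (simp add: G_def)
  ultimately show ?thesis using that by blast
qed

text \<open>The second half of Arzela-Ascoli: given a pointwise limit from
  \<open>pointwise_cluster\<close>, equicontinuity makes the convergence locally uniform. It is
  asked only eventually along G because the barrier modulus holds only for large m.\<close>

locale equicontinuous_family =
  fixes G :: "'i filter" and w :: "'i \<Rightarrow> 'a::metric_space \<Rightarrow> real" and u :: "'a \<Rightarrow> real"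
  assumes nonbot: "G \<noteq> bot"
    and lim: "\<And>x. ((\<lambda>i. w i x) \<longlongrightarrow> u x) G"
    and equi: "\<And>\<epsilon>. \<epsilon> > 0 \<Longrightarrow> \<exists>d>0. \<forall>\<^sub>F i in G. \<forall>x y. dist x y < d \<longrightarrow> \<bar>w i x - w i y\<bar> \<le> \<epsilon>"
begin

lemma limit_modulus:
  assumes "\<epsilon> > 0"
  shows "\<exists>d>0. (\<forall>\<^sub>F i in G. \<forall>x y. dist x y < d \<longrightarrow> \<bar>w i x - w i y\<bar> \<le> \<epsilon>) \<and>
    (\<forall>x y. dist x y < d \<longrightarrow> \<bar>u x - u y\<bar> \<le> \<epsilon>)"
proof -
  obtain d where d: "d > 0" "\<forall>\<^sub>F i in G. \<forall>x y. dist x y < d \<longrightarrow> \<bar>w i x - w i y\<bar> \<le> \<epsilon>"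
    using equi[OF assms] by blast
  moreover have "\<bar>u x - u y\<bar> \<le> \<epsilon>" if "dist x y < d" for x y
  proof (rule tendsto_upperbound)
    show "((\<lambda>i. \<bar>w i x - w i y\<bar>) \<longlongrightarrow> \<bar>u x - u y\<bar>) G" by (intro tendsto_intros lim)
    show "\<forall>\<^sub>F i in G. \<bar>w i x - w i y\<bar> \<le> \<epsilon>" using d(2) by eventually_elim (use that in blast)
  qed (rule nonbot)
  ultimately show ?thesis by blast
qed

lemma continuous_limit: "continuous_on UNIV u"
  unfolding continuous_on_iff dist_real_def
proof (intro ballI allI impI)
  fix x and e :: real assume "e > 0"
  then obtain d where d: "d > 0" "\<forall>x y. dist x y < d \<longrightarrow> \<bar>u x - u y\<bar> \<le> e / 2"
    using limit_modulus[OF half_gt_zero[OF \<open>e > 0\<close>]] by blast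
  have "\<bar>u x' - u x\<bar> < e" if "dist x' x < d" for x'
    using d(2)[rule_format, OF that] \<open>e > 0\<close> by linarith
  with d(1) show "\<exists>d>0. \<forall>x'\<in>UNIV. dist x' x < d \<longrightarrow> \<bar>u x' - u x\<bar> < e" by blast
qed

lemma joint_eventually:
  assumes "\<epsilon> > 0"
  shows "\<exists>d>0. \<forall>\<^sub>F i in G. \<forall>y\<in>ball x d. \<bar>w i y - u x\<bar> < \<epsilon> \<and> \<bar>w i y - u y\<bar> < \<epsilon>"
proof -
  have "\<epsilon> / 4 > 0" using assms by simp
  from limit_modulus[OF this] obtain d where d: "d > 0"
    "\<forall>\<^sub>F i in G. \<forall>x y. dist x y < d \<longrightarrow> \<bar>w i x - w i y\<bar> \<le> \<epsilon> / 4"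
    "\<forall>x y. dist x y < d \<longrightarrow> \<bar>u x - u y\<bar> \<le> \<epsilon> / 4"
    by blast
  have "\<forall>\<^sub>F i in G. \<bar>w i x - u x\<bar> < \<epsilon> / 4"
    using tendstoD[OF lim[of x] \<open>\<epsilon> / 4 > 0\<close>] unfolding dist_real_def .
  with d(2) have "\<forall>\<^sub>F i in G. \<forall>y\<in>ball x d. \<bar>w i y - u x\<bar> < \<epsilon> \<and> \<bar>w i y - u y\<bar> < \<epsilon>"
  proof (eventually_elim, intro ballI)
    fix i y
    assume i: "\<forall>x y. dist x y < d \<longrightarrow> \<bar>w i x - w i y\<bar> \<le> \<epsilon> / 4" "\<bar>w i x - u x\<bar> < \<epsilon> / 4"
      and y: "y \<in> ball x d"
    have "\<bar>w i x - w i y\<bar> \<le> \<epsilon> / 4" "\<bar>u x - u y\<bar> \<le> \<epsilon> / 4"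
      using i(1)[rule_format, of x y] d(3)[rule_format, of x y] y by simp_all
    with i(2) assms show "\<bar>w i y - u x\<bar> < \<epsilon> \<and> \<bar>w i y - u y\<bar> < \<epsilon>" by linarith
  qed
  with d(1) show ?thesis by blast
qed

lemma uniform_on_compact:
  assumes "compact K" "\<epsilon> > 0"
  shows "\<forall>\<^sub>F i in G. \<forall>y\<in>K. \<bar>w i y - u y\<bar> < \<epsilon>"
proof -
  define P where "P x d \<longleftrightarrow> d > 0 \<and> (\<forall>\<^sub>F i in G. \<forall>y\<in>ball x d. \<bar>w i y - u y\<bar> < \<epsilon>)" for x d
  have "\<exists>d. P x d" for x
  proof -
    obtain d where d: "d > 0"
      "\<forall>\<^sub>F i in G. \<forall>y\<in>ball x d. \<bar>w i y - u x\<bar> < \<epsilon> \<and> \<bar>w i y - u y\<bar> < \<epsilon>"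
      using joint_eventually[OF \<open>\<epsilon> > 0\<close>] by blast
    from d(2) have "\<forall>\<^sub>F i in G. \<forall>y\<in>ball x d. \<bar>w i y - u y\<bar> < \<epsilon>"
      by eventually_elim blast
    with d(1) show ?thesis unfolding P_def by blast
  qed
  then obtain d where d: "\<And>x. P x (d x)" by metis
  have "K \<subseteq> (\<Union>x\<in>K. ball x (d x))"
    using d by (auto simp: P_def)
  then obtain D where D: "D \<subseteq> K" "finite D" "K \<subseteq> (\<Union>x\<in>D. ball x (d x))"
    by (rule compactE_image[OF \<open>compact K\<close> open_ball])
  have "\<forall>\<^sub>F i in G. \<forall>x\<in>D. \<forall>y\<in>ball x (d x). \<bar>w i y - u y\<bar> < \<epsilon>"
    using D(2) d unfolding P_def by (intro eventually_ball_finite) blast+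
  then show ?thesis by eventually_elim (use D(3) in blast)
qed

end

section \<open>Passing to the limit in sub- and supersolutions\<close>

lemma viscosity_subsolutionD:
  assumes "viscosity_subsolution F u" "\<phi> \<in> C2_functions" "\<forall>\<^sub>F y in nhds x. u y - \<phi> y \<le> u x - \<phi> x"
  shows "F x (grad \<phi> x) (hess \<phi> x) \<le> 0"
  using assms unfolding viscosity_subsolution_def by blast

lemma viscosity_supersolutionD:
  assumes "viscosity_supersolution F u" "\<phi> \<in> C2_functions" "\<forall>\<^sub>F y in nhds x. u x - \<phi> x \<le> u y - \<phi> y"
  shows "F x (grad \<phi> x) (hess \<phi> x) \<ge> 0"
  using assms unfolding viscosity_supersolution_def by blast

lemma continuous_imp_usc: "continuous_on UNIV u \<Longrightarrow> usc u"
  unfolding usc_def using tendsto_nhds_of_continuous order_tendstoD(2) by metis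

lemma continuous_imp_lsc: "continuous_on UNIV u \<Longrightarrow> lsc u"
  unfolding lsc_def using tendsto_nhds_of_continuous order_tendstoD(1) by metis

text \<open>The reflection from u to -u, by which the stability of supersolutions is read off from
  that of subsolutions.\<close>

lemma viscosity_subsolution_uminus:
  assumes "viscosity_supersolution F u"
  shows "viscosity_subsolution (\<lambda>x p X. - F x (- p) (- X)) (\<lambda>x. - u x)"
  unfolding viscosity_subsolution_def
proof (intro conjI ballI allI impI)
  show "usc (\<lambda>x. - u x)"
    using assms unfolding viscosity_supersolution_def lsc_def usc_def by (simp add: minus_less_iff)
next
  fix \<phi> x assume \<phi>: "\<phi> \<in> C2_functions" "\<forall>\<^sub>F y in nhds x. - u y - \<phi> y \<le> - u x - \<phi> x"
  have "\<forall>\<^sub>F y in nhds x. u x - - \<phi> x \<le> u y - - \<phi> y"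
    using \<phi>(2) by eventually_elim simp
  from viscosity_supersolutionD[OF assms C2_uminus(1)[OF \<phi>(1)] this]
  show "- F x (- grad \<phi> x) (- hess \<phi> x) \<le> 0"
    by (simp add: C2_uminus[OF \<phi>(1)])
qed

lemma radial_quartic_dist: "radial_quartic x 0 1 0 y = dist x y ^ 4"
  by (simp add: radial_quartic_def dist_norm norm_minus_commute flip: power_mult)

text \<open>Adding \<open>|y - x|\<^sup>4\<close> makes the contact at \<open>x\<close> strict without changing the gradient and
  the Hessian there.\<close>

lemma C2_strict_touching:
  fixes \<phi> :: "real^'n \<Rightarrow> real" and x :: "real^'n"
  assumes "\<phi> \<in> C2_functions"
  defines "\<psi> \<equiv> \<lambda>y. \<phi> y + radial_quartic x 0 1 0 y"
  shows "\<psi> \<in> C2_functions" "grad \<psi> x = grad \<phi> x" "trace (hess \<psi> x) = trace (hess \<phi> x)"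
  using C2_add[OF assms(1) radial_quartic_C2(1)[of x 0 1 0]]
  unfolding \<psi>_def by (auto simp: radial_quartic_C2 trace_add)

text \<open>Maximum points of \<open>w i\<close> minus a strictly touching function lie close to x
  and give the inequality for \<open>F i\<close> there. The conclusion stops before any limit of
  \<open>F i\<close> is taken, because \<open>op_m\<close> tends to infinity where |p| > 1.
  Convergence is asked at x only, with a one-sided bound elsewhere, so that the lemma also serves
  suprema of subsolutions.\<close>

lemma subsolution_stability:
  fixes u :: "real^'n \<Rightarrow> real"
  assumes "G \<noteq> bot" and \<phi>: "\<phi> \<in> C2_functions" "\<forall>\<^sub>F y in nhds x. u y - \<phi> y \<le> u x - \<phi> x"
    and sub: "\<forall>\<^sub>F i in G. continuous_on UNIV (w i) \<and> viscosity_subsolution (F i) (w i)"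
    and lim: "((\<lambda>i. w i x) \<longlongrightarrow> u x) G"
    and upper: "\<And>K \<epsilon>. compact K \<Longrightarrow> 0 < \<epsilon> \<Longrightarrow> \<forall>\<^sub>F i in G. \<forall>y\<in>K. w i y < u y + \<epsilon>"
  obtains \<psi> where "\<psi> \<in> C2_functions" "grad \<psi> x = grad \<phi> x" "trace (hess \<psi> x) = trace (hess \<phi> x)"
    "\<exists>\<^sub>F (i, y) in G \<times>\<^sub>F nhds x. F i y (grad \<psi> y) (hess \<psi> y) \<le> 0"
proof
  define \<psi> where "\<psi> = (\<lambda>y. \<phi> y + radial_quartic x 0 1 0 y)"
  note st = C2_strict_touching[OF \<phi>(1), of x, folded \<psi>_def]
  show "\<psi> \<in> C2_functions" "grad \<psi> x = grad \<phi> x" "trace (hess \<psi> x) = trace (hess \<phi> x)"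
    by (rule st)+
  show "\<exists>\<^sub>F (i, y) in G \<times>\<^sub>F nhds x. F i y (grad \<psi> y) (hess \<psi> y) \<le> 0"
  proof (rule ccontr)
    assume "\<not> ?thesis"
    then have "\<forall>\<^sub>F z in G \<times>\<^sub>F nhds x. \<not> (case z of (i, y) \<Rightarrow> F i y (grad \<psi> y) (hess \<psi> y) \<le> 0)"
      by (simp add: not_frequently)
    then obtain P Q where P: "eventually P G" and Q: "eventually Q (nhds x)"
      and pos: "\<And>i y. P i \<Longrightarrow> Q y \<Longrightarrow> \<not> F i y (grad \<psi> y) (hess \<psi> y) \<le> 0"
      unfolding eventually_prod_filter by auto
    have "\<forall>\<^sub>F y in nhds x. u y - \<phi> y \<le> u x - \<phi> x \<and> Q y"
      using \<phi>(2) Q by (rule eventually_conj)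
    then obtain r where r: "r > 0" "\<And>y. dist y x \<le> r \<Longrightarrow> u y - \<phi> y \<le> u x - \<phi> x \<and> Q y"
      unfolding eventually_nhds_metric_le by blast
    \<comment> \<open>On the sphere of radius r the quartic costs r^4, that is twice \<epsilon>: it
      pays for one error from \<open>upper\<close> at the boundary point and one from the
      convergence at x. The maximum is therefore interior.\<close>
    define \<epsilon> where "\<epsilon> = r ^ 4 / 2"
    have "\<epsilon> > 0" using r by (simp add: \<epsilon>_def)
    have "\<forall>\<^sub>F i in G. \<forall>y\<in>cball x r. w i y < u y + \<epsilon>"
      using upper[OF compact_cball \<open>\<epsilon> > 0\<close>] .
    moreover have "\<forall>\<^sub>F i in G. u x - \<epsilon> < w i x"
      using lim \<open>\<epsilon> > 0\<close> by (intro order_tendstoD) auto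
    ultimately have "\<forall>\<^sub>F i in G. False" using sub P
    proof eventually_elim
      case (elim i)
      have c: "continuous_on (cball x r) (\<lambda>y. w i y - \<psi> y)"
        using elim C2_continuous[OF st(1)] by (intro continuous_intros) (auto intro: continuous_on_subset)
      obtain z where z: "z \<in> cball x r" "\<And>y. y \<in> cball x r \<Longrightarrow> w i y - \<psi> y \<le> w i z - \<psi> z"
        using continuous_attains_sup[OF compact_cball _ c] r(1) by (metis cball_eq_empty not_less_iff_gr_or_eq)
      have "dist x z \<noteq> r"
      proof
        assume zr: "dist x z = r"
        have "w i x - \<psi> x \<le> w i z - \<psi> z" using r(1) by (intro z(2)) auto
        moreover have "u z - \<phi> z \<le> u x - \<phi> x" using r(2)[of z] zr by (simp add: dist_commute)
        moreover have "w i z < u z + \<epsilon>" using elim(1) z(1) by blast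
        moreover have "\<psi> x = \<phi> x" "\<psi> z = \<phi> z + 2 * \<epsilon>" by (simp_all add: \<psi>_def radial_quartic_dist zr \<epsilon>_def)
        ultimately show False using elim(2) by linarith
      qed
      then have "z \<in> ball x r" using z(1) by simp
      then have "\<forall>\<^sub>F y in nhds z. y \<in> ball x r" by (intro eventually_nhds_in_open) auto
      then have "\<forall>\<^sub>F y in nhds z. w i y - \<psi> y \<le> w i z - \<psi> z"
        by eventually_elim (use z(2) in auto)
      then have "F i z (grad \<psi> z) (hess \<psi> z) \<le> 0"
        using viscosity_subsolutionD[OF _ st(1)] elim(3) by blast
      then show False using pos[OF elim(4)] r(2)[of z] z(1) by (simp add: dist_commute)
    qed
    then show False using \<open>G \<noteq> bot\<close> by simp
  qed
qed

lemma supersolution_stability: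
  fixes u :: "real^'n \<Rightarrow> real"
  assumes "G \<noteq> bot" and \<phi>: "\<phi> \<in> C2_functions" "\<forall>\<^sub>F y in nhds x. u x - \<phi> x \<le> u y - \<phi> y"
    and super: "\<forall>\<^sub>F i in G. continuous_on UNIV (w i) \<and> viscosity_supersolution (F i) (w i)"
    and lim: "((\<lambda>i. w i x) \<longlongrightarrow> u x) G"
    and lower: "\<And>K \<epsilon>. compact K \<Longrightarrow> 0 < \<epsilon> \<Longrightarrow> \<forall>\<^sub>F i in G. \<forall>y\<in>K. u y - \<epsilon> < w i y"
  obtains \<psi> where "\<psi> \<in> C2_functions" "grad \<psi> x = grad \<phi> x" "trace (hess \<psi> x) = trace (hess \<phi> x)"
    "\<exists>\<^sub>F (i, y) in G \<times>\<^sub>F nhds x. 0 \<le> F i y (grad \<psi> y) (hess \<psi> y)"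
proof -
  have 1: "\<forall>\<^sub>F y in nhds x. - u y - - \<phi> y \<le> - u x - - \<phi> x"
    using \<phi>(2) by eventually_elim simp
  have 2: "\<forall>\<^sub>F i in G. continuous_on UNIV (\<lambda>y. - w i y) \<and>
      viscosity_subsolution (\<lambda>x p X. - F i x (- p) (- X)) (\<lambda>y. - w i y)"
    using super by eventually_elim (auto intro: viscosity_subsolution_uminus continuous_intros)
  have 3: "\<forall>\<^sub>F i in G. \<forall>y\<in>K. - w i y < - u y + \<epsilon>" if "compact K" "0 < \<epsilon>" for K \<epsilon>
    using lower[OF that] by eventually_elim force
  obtain \<psi> where \<psi>: "\<psi> \<in> C2_functions" "grad \<psi> x = - grad \<phi> x" "trace (hess \<psi> x) = - trace (hess \<phi> x)"
    and fr: "\<exists>\<^sub>F (i, y) in G \<times>\<^sub>F nhds x. - F i y (- grad \<psi> y) (- hess \<psi> y) \<le> 0"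
    by (rule subsolution_stability[OF assms(1) C2_uminus(1)[OF \<phi>(1)] 1 2 _ 3])
      (auto simp: C2_uminus[OF \<phi>(1)] trace_uminus intro: tendsto_minus lim)
  show ?thesis
    by (rule that[OF C2_uminus(1)[OF \<psi>(1)]])
      (use \<psi> fr in \<open>simp_all add: C2_uminus[OF \<psi>(1)] trace_uminus\<close>)
qed

lemma tendsto_op_infty:
  fixes f :: "'i \<Rightarrow> real^'n \<Rightarrow> real"
  assumes \<phi>: "\<phi> \<in> C2_functions" and f: "((\<lambda>(i, y). f i y) \<longlongrightarrow> g x) (G \<times>\<^sub>F nhds x)"
    and l: "(l \<longlongrightarrow> k) G"
  shows "((\<lambda>(i, y). op_infty (f i) (l i) y (grad \<phi> y) (hess \<phi> y)) \<longlongrightarrow>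
    op_infty g k x (grad \<phi> x) (hess \<phi> x)) (G \<times>\<^sub>F nhds x)"
proof -
  have l': "((\<lambda>z. l (fst z)) \<longlongrightarrow> k) (G \<times>\<^sub>F nhds x)"
    by (rule filterlim_compose[OF l filterlim_fst])
  have tr: "((\<lambda>z. trace (hess \<phi> (snd z))) \<longlongrightarrow> trace (hess \<phi> x)) (G \<times>\<^sub>F nhds x)"
    by (intro tendsto_snd_nhds continuous_intros C2_hess_continuous \<phi>)
  have gr: "((\<lambda>z. norm (grad \<phi> (snd z))) \<longlongrightarrow> norm (grad \<phi> x)) (G \<times>\<^sub>F nhds x)"
    by (intro tendsto_snd_nhds continuous_intros C2_grad_continuous \<phi>)
  show ?thesis
    using tendsto_max[OF tendsto_diff[OF tendsto_diff[OF l' tr] f] tendsto_diff[OF gr tendsto_const[of 1]]]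
    by (simp add: op_infty_def split_def)
qed

lemma frequently_nonpos_limit:
  fixes a :: real
  assumes "(h \<longlongrightarrow> a) F" "\<exists>\<^sub>F z in F. h z \<le> 0"
  shows "a \<le> 0"
proof (rule ccontr)
  assume "\<not> ?thesis"
  then have "\<forall>\<^sub>F z in F. 0 < h z" using assms(1) by (intro order_tendstoD) auto
  with assms(2) show False by (simp add: frequently_def not_le)
qed

lemma op_infty_cong_trace:
  "trace X = trace Y \<Longrightarrow> op_infty f l x p X = op_infty f l x p Y"
  by (simp add: op_infty_def)

lemma op_infty_subsolution_limit:
  fixes u :: "real^'n \<Rightarrow> real"
  assumes "G \<noteq> bot" and \<phi>: "\<phi> \<in> C2_functions" "\<forall>\<^sub>F y in nhds x. u y - \<phi> y \<le> u x - \<phi> x"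
    and sub: "\<forall>\<^sub>F i in G. continuous_on UNIV (w i) \<and> viscosity_subsolution (op_infty (f i) (l i)) (w i)"
    and lim: "((\<lambda>i. w i x) \<longlongrightarrow> u x) G"
    and upper: "\<And>K \<epsilon>. compact K \<Longrightarrow> 0 < \<epsilon> \<Longrightarrow> \<forall>\<^sub>F i in G. \<forall>y\<in>K. w i y < u y + \<epsilon>"
    and f: "((\<lambda>(i, y). f i y) \<longlongrightarrow> g x) (G \<times>\<^sub>F nhds x)" and l: "(l \<longlongrightarrow> k) G"
  shows "op_infty g k x (grad \<phi> x) (hess \<phi> x) \<le> 0"
proof -
  obtain \<psi> where \<psi>: "\<psi> \<in> C2_functions" "grad \<psi> x = grad \<phi> x" "trace (hess \<psi> x) = trace (hess \<phi> x)"
    "\<exists>\<^sub>F (i, y) in G \<times>\<^sub>F nhds x. op_infty (f i) (l i) y (grad \<psi> y) (hess \<psi> y) \<le> 0"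
    by (rule subsolution_stability[OF assms(1-6)])
  have "op_infty g k x (grad \<psi> x) (hess \<psi> x) \<le> 0"
    by (rule frequently_nonpos_limit[OF tendsto_op_infty[where g=g and x=x, OF \<psi>(1) f l]]) (use \<psi>(4) in \<open>simp add: split_def\<close>)
  then show ?thesis using \<psi>(2) op_infty_cong_trace[OF \<psi>(3)] by metis
qed

lemma op_infty_supersolution_limit:
  fixes u :: "real^'n \<Rightarrow> real"
  assumes "G \<noteq> bot" and \<phi>: "\<phi> \<in> C2_functions" "\<forall>\<^sub>F y in nhds x. u x - \<phi> x \<le> u y - \<phi> y"
    and super: "\<forall>\<^sub>F i in G. continuous_on UNIV (w i) \<and> viscosity_supersolution (op_infty (f i) (l i)) (w i)"
    and lim: "((\<lambda>i. w i x) \<longlongrightarrow> u x) G"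
    and lower: "\<And>K \<epsilon>. compact K \<Longrightarrow> 0 < \<epsilon> \<Longrightarrow> \<forall>\<^sub>F i in G. \<forall>y\<in>K. u y - \<epsilon> < w i y"
    and f: "((\<lambda>(i, y). f i y) \<longlongrightarrow> g x) (G \<times>\<^sub>F nhds x)" and l: "(l \<longlongrightarrow> k) G"
  shows "0 \<le> op_infty g k x (grad \<phi> x) (hess \<phi> x)"
proof -
  obtain \<psi> where \<psi>: "\<psi> \<in> C2_functions" "grad \<psi> x = grad \<phi> x" "trace (hess \<psi> x) = trace (hess \<phi> x)"
    "\<exists>\<^sub>F (i, y) in G \<times>\<^sub>F nhds x. 0 \<le> op_infty (f i) (l i) y (grad \<psi> y) (hess \<psi> y)"
    by (rule supersolution_stability[OF assms(1-6)])
  have "- op_infty g k x (grad \<psi> x) (hess \<psi> x) \<le> 0"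
    by (rule frequently_nonpos_limit[OF tendsto_minus[OF tendsto_op_infty[where g=g and x=x, OF \<psi>(1) f l]]])
      (use \<psi>(4) in \<open>simp add: split_def\<close>)
  then show ?thesis using \<psi>(2) op_infty_cong_trace[OF \<psi>(3)] by (metis neg_le_0_iff_le)
qed

section \<open>The limit of the eigenvalues\<close>

lemma Lipschitz_loc_Holder:
  assumes u: "u \<in> loc_Holder 1" and \<gamma>: "0 < \<gamma>" "\<gamma> \<le> 1"
  shows "u \<in> loc_Holder \<gamma>"
  unfolding loc_Holder_def
proof (intro CollectI allI impI)
  fix R :: real assume "R > 0"
  then obtain C where C: "\<And>x y. norm x < R \<Longrightarrow> norm y < R \<Longrightarrow> \<bar>u x - u y\<bar> \<le> C * dist x y powr 1"
    using loc_HolderE[OF u] by blast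
  have "\<bar>u x - u y\<bar> \<le> (\<bar>C\<bar> * (2 * R) powr (1 - \<gamma>)) * dist x y powr \<gamma>"
    if xy: "norm x < R" "norm y < R" for x y
  proof (cases "x = y")
    case False
    have "dist x y \<le> 2 * R" using xy norm_triangle_ineq4[of x y] by (simp add: dist_norm)
    then have "dist x y powr (1 - \<gamma>) \<le> (2 * R) powr (1 - \<gamma>)" using \<gamma> by (intro powr_mono2) auto
    then have "dist x y powr (1 - \<gamma>) * dist x y powr \<gamma> \<le> (2 * R) powr (1 - \<gamma>) * dist x y powr \<gamma>"
      by (intro mult_right_mono) auto
    moreover have "dist x y powr (1 - \<gamma>) * dist x y powr \<gamma> = dist x y powr 1"
      by (simp flip: powr_add)
    ultimately have "\<bar>C\<bar> * dist x y powr 1 \<le> \<bar>C\<bar> * ((2 * R) powr (1 - \<gamma>) * dist x y powr \<gamma>)"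
      by (intro mult_left_mono) auto
    moreover have "C * dist x y powr 1 \<le> \<bar>C\<bar> * dist x y powr 1" by (intro mult_right_mono) auto
    ultimately show ?thesis using C[OF xy] by (simp only: mult.assoc)
  qed simp
  then show "\<exists>C. \<forall>x\<in>ball 0 R. \<forall>y\<in>ball 0 R. \<bar>u x - u y\<bar> \<le> C * dist x y powr \<gamma>"
    by (intro exI[of _ "\<bar>C\<bar> * (2 * R) powr (1 - \<gamma>)"] ballI) simp
qed

lemma subsolution_infty_imp_m:
  assumes sub: "viscosity_subsolution (op_infty f l) u" and "m > 0"
  shows "viscosity_subsolution (op_m m f (l - 1 / m)) u"
  unfolding viscosity_subsolution_def
proof (intro conjI ballI allI impI)
  show "usc u" using sub unfolding viscosity_subsolution_def by simp
next
  fix \<phi> x assume "\<phi> \<in> C2_functions" "\<forall>\<^sub>F y in nhds x. u y - \<phi> y \<le> u x - \<phi> x"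
  from viscosity_subsolutionD[OF sub this]
  have le: "l - trace (hess \<phi> x) - f x \<le> 0" "norm (grad \<phi> x) \<le> 1" by (simp_all add: op_infty_def)
  have "norm (grad \<phi> x) powr m \<le> 1" using le(2) \<open>m > 0\<close> by (intro powr_le1) auto
  then have "(1 / m) * norm (grad \<phi> x) powr m \<le> (1 / m) * 1"
    using \<open>m > 0\<close> by (intro mult_left_mono) auto
  with le(1) show "op_m m f (l - 1 / m) x (grad \<phi> x) (hess \<phi> x) \<le> 0"
    by (simp add: op_m_def)
qed

lemma lambda_infty_le_lambda_m:
  assumes "m > 2"
  shows "lambda_infty f \<le> lambda_m m f + ereal (1 / m)"
  unfolding lambda_infty_def
proof (rule Sup_least, clarify)
  fix l u assume u: "u \<in> loc_Holder 1" "u 0 = 0" "viscosity_subsolution (op_infty f l) u"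
  have "u \<in> loc_Holder ((m - 2) / (m - 1))" using assms by (intro Lipschitz_loc_Holder[OF u(1)]) auto
  moreover have "viscosity_subsolution (op_m m f (l - 1 / m)) u"
    using assms by (intro subsolution_infty_imp_m[OF u(3)]) auto
  ultimately have "ereal (l - 1 / m) \<le> lambda_m m f"
    unfolding lambda_m_def using u(2) by (intro Sup_upper) blast
  then have "ereal (l - 1 / m) + ereal (1 / m) \<le> lambda_m m f + ereal (1 / m)"
    by (rule add_right_mono)
  then show "ereal l \<le> lambda_m m f + ereal (1 / m)" by simp
qed

section \<open>From the m-equation to the constrained equation\<close>

lemma linear_growth:
  fixes w :: "'a::real_normed_vector \<Rightarrow> real"
  assumes step: "\<And>x y. dist x y \<le> 1 \<Longrightarrow> \<bar>w x - w y\<bar> \<le> B"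
  shows "\<bar>w x - w 0\<bar> \<le> B * (norm x + 1)"
proof -
  have "B \<ge> 0" using step[of 0 0] by simp
  have *: "\<bar>w x - w 0\<bar> \<le> B * real n" if "norm x \<le> real n" for n x
    using that
  proof (induction n arbitrary: x)
    case (Suc n)
    \<comment> \<open>Shrinking by the factor n / (n + 1) brings x into the ball of radius n and
      moves it by at most 1, so a single use of \<open>step\<close> closes the induction.\<close>
    define t where "t = real n / real (Suc n)"
    have t: "0 \<le> t" "t \<le> 1" "1 - t = 1 / real (Suc n)" by (simp_all add: t_def field_simps)
    have "norm (t *\<^sub>R x) \<le> t * real (Suc n)" using Suc.prems t by (simp add: mult_left_mono)
    then have "\<bar>w (t *\<^sub>R x) - w 0\<bar> \<le> B * real n" by (intro Suc.IH) (simp add: t_def)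
    moreover have "x - t *\<^sub>R x = (1 - t) *\<^sub>R x" by (simp add: algebra_simps)
    then have "dist x (t *\<^sub>R x) \<le> 1" using Suc.prems t by (simp add: dist_norm)
    then have "\<bar>w x - w (t *\<^sub>R x)\<bar> \<le> B" by (rule step)
    ultimately show ?case by (simp add: algebra_simps)
  qed simp
  have "\<bar>w x - w 0\<bar> \<le> B * real (nat \<lceil>norm x\<rceil>)" by (rule *) linarith
  also have "\<dots> \<le> B * (norm x + 1)"
    using \<open>B \<ge> 0\<close> by (intro mult_left_mono) (auto simp: of_int_ceiling_le_add_one)
  finally show ?thesis .
qed

lemma one_Lipschitz_loc_Holder:
  assumes "\<And>x y. \<bar>u x - u y\<bar> \<le> dist x y"
  shows "u \<in> loc_Holder 1"
  unfolding loc_Holder_def using assms by (auto intro!: exI[of _ 1])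

lemma barrier_small:
  assumes "\<epsilon> > 0"
  obtains d where "0 < d" "d \<le> 1" "\<And>s. 0 \<le> s \<Longrightarrow> s < d \<Longrightarrow> barrier (s\<^sup>2) < \<epsilon>"
proof -
  have "((\<lambda>s. barrier (s\<^sup>2)) \<longlongrightarrow> 10 * ((0\<^sup>2) powr (1/4) + 1 - sqrt (1 - 0\<^sup>2))) (at_right 0)"
    unfolding barrier_def by (intro tendsto_intros tendsto_powr') auto
  then have "((\<lambda>s. barrier (s\<^sup>2)) \<longlongrightarrow> 0) (at_right 0)" by simp
  then have "\<forall>\<^sub>F s in at_right 0. barrier (s\<^sup>2) < \<epsilon>" using assms by (rule order_tendstoD)
  then obtain b where b: "b > 0" "\<And>s. 0 < s \<Longrightarrow> s < b \<Longrightarrow> barrier (s\<^sup>2) < \<epsilon>"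
    unfolding eventually_at_right_field by auto
  have "barrier (s\<^sup>2) < \<epsilon>" if "0 \<le> s" "s < min b 1" for s
    using that b(2)[of s] assms by (cases "s = 0") (auto simp: barrier_def)
  then show ?thesis using that[of "min b 1"] b(1) by auto
qed

text \<open>In the limit \<open>m \<rightarrow> \<infinity>\<close> the term \<open>|p|\<^sup>m / m\<close> is harmless for \<open>|p| \<le> 1\<close> and blows up
  for \<open>|p| > 1\<close>, which produces the gradient constraint.\<close>

lemma op_m_eventually_pos:
  fixes \<psi> :: "real^'n \<Rightarrow> real"
  assumes \<psi>: "\<psi> \<in> C2_functions" and f: "continuous_on UNIV f" and G: "G \<le> at_top"
    and pos: "op_infty f l x (grad \<psi> x) (hess \<psi> x) > 0"
  shows "\<forall>\<^sub>F (m, y) in G \<times>\<^sub>F nhds x. 0 < op_m m f l y (grad \<psi> y) (hess \<psi> y)"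
proof -
  define a where "a y = l - trace (hess \<psi> y) - f y" for y
  have a: "(a \<longlongrightarrow> a x) (nhds x)"
    unfolding a_def[abs_def] by (intro tendsto_nhds_of_continuous continuous_intros C2_hess_continuous \<psi> f)
  have g: "((\<lambda>y. norm (grad \<psi> y)) \<longlongrightarrow> norm (grad \<psi> x)) (nhds x)"
    by (intro tendsto_nhds_of_continuous continuous_intros C2_grad_continuous \<psi>)
  have op: "op_m m f l y (grad \<psi> y) (hess \<psi> y) = a y + (1 / m) * norm (grad \<psi> y) powr m" for m y
    by (simp add: op_m_def a_def)
  have m0: "\<forall>\<^sub>F m in G. m > (0::real)"
    using G eventually_gt_at_top by (rule filter_leD)
  consider "a x > 0" | "norm (grad \<psi> x) > 1"
    using pos by (force simp: op_infty_def a_def)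
  then show ?thesis
  proof cases
    case 1
    then have "\<forall>\<^sub>F y in nhds x. 0 < a y" using a by (rule order_tendstoD(1)[rotated])
    with m0 show ?thesis unfolding eventually_prod_filter op
      by (force intro!: add_pos_nonneg)
  next
    case 2
    \<comment> \<open>A fixed q > 1 that stays below the gradient norm on a whole neighbourhood
      makes the blow-up of q^m / m uniform in y.\<close>
    then obtain q where q: "1 < q" "q < norm (grad \<psi> x)" using dense by blast
    have q1: "\<forall>\<^sub>F y in nhds x. q < norm (grad \<psi> y)" using g q(2) by (rule order_tendstoD)
    have a1: "\<forall>\<^sub>F y in nhds x. a x - 1 < a y" using a by (rule order_tendstoD) simp
    have "filterlim (\<lambda>m. (1 / m) * q powr m) at_top at_top"
      using q(1) by real_asymp
    then have "\<forall>\<^sub>F m in at_top. 1 - a x \<le> (1 / m) * q powr m"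
      unfolding filterlim_at_top by blast
    then have "\<forall>\<^sub>F m in G. 1 - a x \<le> (1 / m) * q powr m" by (rule filter_leD[OF G])
    with m0 have m1: "\<forall>\<^sub>F m in G. 0 < m \<and> 1 - a x \<le> (1 / m) * q powr m" by (rule eventually_conj)
    have "0 < op_m m f l y (grad \<psi> y) (hess \<psi> y)"
      if m: "0 < m \<and> 1 - a x \<le> (1 / m) * q powr m" and y: "q < norm (grad \<psi> y) \<and> a x - 1 < a y" for m y
    proof -
      have "(1 / m) * q powr m \<le> (1 / m) * norm (grad \<psi> y) powr m"
        using m y q(1) by (intro mult_left_mono powr_mono2) auto
      then show ?thesis using m y unfolding op by linarith
    qed
    then show ?thesis unfolding eventually_prod_filter case_prod_conv
      by (intro exI[of _ "\<lambda>m. 0 < m \<and> 1 - a x \<le> (1 / m) * q powr m"]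
          exI[of _ "\<lambda>y. q < norm (grad \<psi> y) \<and> a x - 1 < a y"] conjI m1 eventually_conj[OF q1 a1]) blast
  qed
qed

text \<open>Subsolutions are assumed only for arbitrarily large m, which is what a failure of the
  upper bound on the limit provides. The approximants are controlled merely by the barrier; the
  Lipschitz bound of the limit comes from the constraint it inherits.\<close>

lemma subsolution_m_limit:
  fixes f :: "real^'n \<Rightarrow> real"
  assumes f: "continuous_on UNIV f" and K: "\<And>x. f x \<le> K"
    and fr: "\<exists>\<^sub>F m in at_top. \<exists>u\<in>loc_Holder ((m - 2) / (m - 1)). u 0 = 0 \<and>
      viscosity_subsolution (op_m m f l) u"
  shows "\<exists>u\<in>loc_Holder 1. u 0 = 0 \<and> viscosity_subsolution (op_infty f l) u"
proof -
  define S where "S = {m. \<exists>u\<in>loc_Holder ((m - 2) / (m - 1)). u 0 = 0 \<and> viscosity_subsolution (op_m m f l) u}"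
  \<comment> \<open>This filter is nontrivial because S contains arbitrarily large m, and along it a
    subsolution is always at hand.\<close>
  define F where "F = inf at_top (principal S)"
  have "F \<noteq> bot"
    using fr unfolding F_def trivial_limit_def eventually_inf_principal S_def frequently_def by simp
  have F: "F \<le> at_top" by (simp add: F_def)
  have "\<forall>m\<in>S. \<exists>u. u \<in> loc_Holder ((m - 2) / (m - 1)) \<and> u 0 = 0 \<and> viscosity_subsolution (op_m m f l) u"
    unfolding S_def by blast
  then obtain w where w: "\<And>m. m \<in> S \<Longrightarrow> w m \<in> loc_Holder ((m - 2) / (m - 1))"
    "\<And>m. m \<in> S \<Longrightarrow> w m 0 = 0" "\<And>m. m \<in> S \<Longrightarrow> viscosity_subsolution (op_m m f l) (w m)"
    by metis
  define M where "M = max 0 (K - l)"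
  have "filterlim (\<lambda>m::real. 2 powr m / m) at_top at_top" by real_asymp
  then have "\<forall>\<^sub>F m in at_top. M + 20 * real CARD('n) + 14 < 2 powr m / m"
    unfolding filterlim_at_top_dense by blast
  then have "\<forall>\<^sub>F m in at_top. 3 < m \<and> M + 20 * real CARD('n) + 14 < 2 powr m / m"
    by (intro eventually_conj eventually_gt_at_top)
  then have ev: "\<forall>\<^sub>F m in F. m \<in> S \<and> 3 < m \<and> M + 20 * real CARD('n) + 14 < 2 powr m / m"
    unfolding F_def eventually_inf_principal by eventually_elim blast
  have evmod: "\<forall>\<^sub>F m in F. m > 3 \<and> m \<in> S \<and> (\<forall>x y. dist x y \<le> 1 \<longrightarrow> \<bar>w m x - w m y\<bar> \<le> barrier ((dist x y)\<^sup>2))"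
    using ev
  proof eventually_elim
    case (elim m)
    have "w m x - w m y \<le> barrier ((dist x y)\<^sup>2)" if "dist x y \<le> 1" for x y
    proof (rule subsolution_m_modulus[OF _ w(1) w(3) _ _ _ that])
      show "f x \<le> l + M" for x using K[of x] by (simp add: M_def)
    qed (use elim in \<open>auto simp: M_def\<close>)
    then have "\<bar>w m x - w m y\<bar> \<le> barrier ((dist x y)\<^sup>2)" if "dist x y \<le> 1" for x y
      using that by (metis abs_le_iff dist_commute minus_diff_eq)
    then show ?case using elim by blast
  qed
  have b1: "barrier (t\<^sup>2) \<le> 20" if "0 \<le> t" "t \<le> 1" for t
  proof -
    have "(t\<^sup>2) powr (1/4) \<le> 1" using that by (intro powr_le1) (auto simp: power_le_one)
    moreover have "sqrt (1 - t\<^sup>2) \<ge> 0" using that by (simp add: power_le_one)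
    ultimately have "barrier (t\<^sup>2) \<le> 10 * (1 + 1 - 0)"
      unfolding barrier_def by (intro mult_left_mono diff_mono add_mono) auto
    then show ?thesis by simp
  qed
  have "\<forall>\<^sub>F m in F. \<forall>x. \<bar>w m x\<bar> \<le> 20 * (norm x + 1)"
    using evmod
  proof eventually_elim
    case (elim m)
    have "\<bar>w m x - w m y\<bar> \<le> 20" if "dist x y \<le> 1" for x y
      using elim that b1[of "dist x y"] by force
    then have "\<bar>w m x - w m 0\<bar> \<le> 20 * (norm x + 1)" for x by (rule linear_growth)
    then show ?case using w(2)[of m] elim by simp
  qed
  then obtain G u where G: "G \<le> F" "G \<noteq> bot" and lim: "\<And>x. ((\<lambda>m. w m x) \<longlongrightarrow> u x) G"
    using pointwise_cluster[OF \<open>F \<noteq> bot\<close>, of w "\<lambda>x. 20 * (norm x + 1)"] by blast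
  have evG: "\<forall>\<^sub>F m in G. m > 3 \<and> m \<in> S \<and> (\<forall>x y. dist x y \<le> 1 \<longrightarrow> \<bar>w m x - w m y\<bar> \<le> barrier ((dist x y)\<^sup>2))"
    by (rule filter_leD[OF G(1) evmod])
  interpret equicontinuous_family G w u
  proof
    fix \<epsilon> :: real assume "\<epsilon> > 0"
    then obtain d where d: "0 < d" "d \<le> 1" "\<And>s. 0 \<le> s \<Longrightarrow> s < d \<Longrightarrow> barrier (s\<^sup>2) < \<epsilon>"
      using barrier_small by blast
    from evG have "\<forall>\<^sub>F m in G. \<forall>x y. dist x y < d \<longrightarrow> \<bar>w m x - w m y\<bar> \<le> \<epsilon>"
    proof (eventually_elim, intro allI impI)
      fix m and x y :: "real^'n"
      assume m: "m > 3 \<and> m \<in> S \<and> (\<forall>x y. dist x y \<le> 1 \<longrightarrow> \<bar>w m x - w m y\<bar> \<le> barrier ((dist x y)\<^sup>2))"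
        and xy: "dist x y < d"
      have "\<bar>w m x - w m y\<bar> \<le> barrier ((dist x y)\<^sup>2)" using m xy d(2) by simp
      with d(3)[OF _ xy] show "\<bar>w m x - w m y\<bar> \<le> \<epsilon>" by simp
    qed
    with d(1) show "\<exists>d>0. \<forall>\<^sub>F m in G. \<forall>x y. dist x y < d \<longrightarrow> \<bar>w m x - w m y\<bar> \<le> \<epsilon>" by blast
  qed (rule G lim)+
  have sub: "viscosity_subsolution (op_infty f l) u"
    unfolding viscosity_subsolution_def
  proof (intro conjI ballI allI impI)
    show "usc u" by (rule continuous_imp_usc[OF continuous_limit])
  next
    fix \<phi> x assume \<phi>: "\<phi> \<in> C2_functions" "\<forall>\<^sub>F y in nhds x. u y - \<phi> y \<le> u x - \<phi> x"
    have wsub: "\<forall>\<^sub>F m in G. continuous_on UNIV (w m) \<and> viscosity_subsolution (op_m m f l) (w m)"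
      using evG by eventually_elim (auto intro!: w(3) loc_Holder_continuous[OF w(1)])
    have upper: "\<forall>\<^sub>F m in G. \<forall>y\<in>K. w m y < u y + \<epsilon>" if "compact K" "\<epsilon> > 0" for K \<epsilon>
      using uniform_on_compact[OF that] by eventually_elim (auto simp: abs_less_iff algebra_simps)
    obtain \<psi> where \<psi>: "\<psi> \<in> C2_functions" "grad \<psi> x = grad \<phi> x" "trace (hess \<psi> x) = trace (hess \<phi> x)"
      "\<exists>\<^sub>F (m, y) in G \<times>\<^sub>F nhds x. op_m m f l y (grad \<psi> y) (hess \<psi> y) \<le> 0"
      by (rule subsolution_stability[OF nonbot \<phi> wsub lim upper])
    have "\<not> op_infty f l x (grad \<psi> x) (hess \<psi> x) > 0"
      using op_m_eventually_pos[OF \<psi>(1) f order_trans[OF G(1) F], of l x] \<psi>(4)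
      by (auto simp: frequently_def split_def not_le)
    then show "op_infty f l x (grad \<phi> x) (hess \<phi> x) \<le> 0"
      using \<psi>(2) op_infty_cong_trace[OF \<psi>(3)] by (metis not_le)
  qed
  have "u 0 = 0"
  proof (rule tendsto_unique[OF nonbot lim])
    have "\<forall>\<^sub>F m in G. w m 0 = 0" using evG by eventually_elim (use w(2) in blast)
    then show "((\<lambda>m. w m 0) \<longlongrightarrow> 0) G" by (rule tendsto_eventually)
  qed
  then show ?thesis
    using sub one_Lipschitz_loc_Holder[OF subsolution_infty_1_Lipschitz[OF continuous_limit sub]] by blast
qed

text \<open>A 1-Lipschitz function rises by at most 3 over distance 3, less than the 9/2 of the
  paraboloid |y - x|^2 / 2, so a translate of the paraboloid touches u from above within that
  distance, and its Laplacian is N. This bounds \<open>lambda_infty\<close> from above and later the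
  discount.\<close>

lemma subsolution_infty_contact:
  fixes u :: "real^'n \<Rightarrow> real"
  assumes cu: "continuous_on UNIV u" and sub: "viscosity_subsolution (op_infty f l) u"
  obtains z where "dist x z < 3" "l - real CARD('n) \<le> f z"
proof -
  define \<phi> where "\<phi> = radial_quartic x (1/2) 0 0"
  have \<phi>: "\<phi> \<in> C2_functions" unfolding \<phi>_def by (rule radial_quartic_C2)
  have val: "\<phi> y = (dist x y)\<^sup>2 / 2" for y
    by (simp add: \<phi>_def radial_quartic_def dist_norm norm_minus_commute)
  have c: "continuous_on (cball x 3) (\<lambda>y. u y - \<phi> y)"
    using cu C2_continuous[OF \<phi>] by (intro continuous_intros) (auto intro: continuous_on_subset)
  have "cball x 3 \<noteq> {}" by simp
  from continuous_attains_sup[OF compact_cball this c]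
  obtain z where z: "z \<in> cball x 3" "\<And>y. y \<in> cball x 3 \<Longrightarrow> u y - \<phi> y \<le> u z - \<phi> z" by blast
  have "dist x z \<noteq> 3"
  proof
    assume "dist x z = 3"
    then have "\<phi> z = 9 / 2" "\<phi> x = 0" by (simp_all add: val)
    moreover have "u x - \<phi> x \<le> u z - \<phi> z" by (rule z(2)) simp
    moreover have "\<bar>u z - u x\<bar> \<le> 3"
      using subsolution_infty_1_Lipschitz[OF cu sub, of z x] \<open>dist x z = 3\<close> by (simp add: dist_commute)
    ultimately show False by linarith
  qed
  then have dz: "dist x z < 3" using z(1) by simp
  have "\<forall>\<^sub>F y in nhds z. y \<in> ball x 3" using dz by (intro eventually_nhds_in_open) auto
  then have "\<forall>\<^sub>F y in nhds z. u y - \<phi> y \<le> u z - \<phi> z" by eventually_elim (simp add: z(2))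
  from viscosity_subsolutionD[OF sub \<phi> this] have "l - real CARD('n) \<le> f z"
    by (simp add: op_infty_def \<phi>_def radial_quartic_C2)
  with dz show ?thesis using that by blast
qed

section \<open>Perron's method for the discounted equation\<close>

lemma op_infty_shift: "op_infty (\<lambda>x. f x - c) l = op_infty f (l + c)"
  by (intro ext) (simp add: op_infty_def)

lemma viscosity_solution_diff_const:
  assumes v: "continuous_on UNIV v" and sol: "viscosity_solution F v"
  shows "viscosity_solution F (\<lambda>x. v x - k)"
  unfolding viscosity_solution_def viscosity_subsolution_def viscosity_supersolution_def
proof (intro conjI ballI allI impI)
  have c: "continuous_on UNIV (\<lambda>x. v x - k)" using v by (intro continuous_intros)
  then show "usc (\<lambda>x. v x - k)" "lsc (\<lambda>x. v x - k)"
    by (rule continuous_imp_usc continuous_imp_lsc)+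
next
  fix \<phi> x assume \<phi>: "\<phi> \<in> C2_functions" "\<forall>\<^sub>F y in nhds x. v y - k - \<phi> y \<le> v x - k - \<phi> x"
  have "\<forall>\<^sub>F y in nhds x. v y - \<phi> y \<le> v x - \<phi> x" using \<phi>(2) by eventually_elim simp
  then show "F x (grad \<phi> x) (hess \<phi> x) \<le> 0"
    using sol \<phi>(1) viscosity_subsolutionD unfolding viscosity_solution_def by blast
next
  fix \<phi> x assume \<phi>: "\<phi> \<in> C2_functions" "\<forall>\<^sub>F y in nhds x. v x - k - \<phi> x \<le> v y - k - \<phi> y"
  have "\<forall>\<^sub>F y in nhds x. v x - \<phi> x \<le> v y - \<phi> y" using \<phi>(2) by eventually_elim simp
  then show "0 \<le> F x (grad \<phi> x) (hess \<phi> x)"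
    using sol \<phi>(1) viscosity_supersolutionD unfolding viscosity_solution_def by blast
qed

lemma one_Lipschitz_continuous:
  assumes "\<And>x y. \<bar>v x - v y\<bar> \<le> dist x (y :: 'a::metric_space)"
  shows "continuous_on UNIV (v :: 'a \<Rightarrow> real)"
  unfolding continuous_on_iff dist_real_def using assms order_le_less_trans by blast

locale discounted_problem =
  fixes f w :: "real^'n \<Rightarrow> real" and l \<delta> M :: real
  assumes f: "continuous_on UNIV f" and f_le: "f x \<le> M"
    and w: "continuous_on UNIV w" and w_sub: "viscosity_subsolution (op_infty f l) w"
    and \<delta>: "\<delta> > 0"
begin

text \<open>An operator F x p X does not see the value of the unknown, so the discount is moved into
  the right-hand side, which then depends on v itself.\<close>

definition rhs :: "(real^'n \<Rightarrow> real) \<Rightarrow> real^'n \<Rightarrow> real" where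
  "rhs v x = f x - \<delta> * (v x - w x)"

definition subsols :: "(real^'n \<Rightarrow> real) set" where
  "subsols = {v. continuous_on UNIV v \<and> viscosity_subsolution (op_infty (rhs v) l) v}"

definition perron :: "real^'n \<Rightarrow> real" where
  "perron x = (SUP v\<in>subsols. v x)"

lemma w_in_subsols: "w \<in> subsols"
proof -
  have "rhs w = f" by (intro ext) (simp add: rhs_def)
  then show ?thesis using w w_sub by (simp add: subsols_def)
qed

lemma subsols_Lipschitz: "v \<in> subsols \<Longrightarrow> \<bar>v x - v y\<bar> \<le> dist x y"
  unfolding subsols_def by (auto intro: subsolution_infty_1_Lipschitz)

text \<open>At the contact point z the equation bounds the discount by M - l + N. Going from z to x
  changes v and w by at most 3 each, whence \<open>6 * \<delta>\<close>.\<close>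

lemma subsols_bound:
  assumes v: "v \<in> subsols"
  shows "\<delta> * (v x - w x) \<le> M - l + real CARD('n) + 6 * \<delta>"
proof -
  obtain z where z: "dist x z < 3" "l - real CARD('n) \<le> rhs v z"
    using v unfolding subsols_def by (blast intro: subsolution_infty_contact)
  have "v x - v z \<le> 3" "w z - w x \<le> 3"
    using subsols_Lipschitz[OF v, of x z] subsols_Lipschitz[OF w_in_subsols, of z x] z(1)
    by (simp_all add: dist_commute)
  then have "\<delta> * (v x - w x) \<le> \<delta> * (v z - w z + 6)" using \<delta> by (intro mult_left_mono) auto
  also have "\<dots> \<le> M - l + real CARD('n) + 6 * \<delta>"
    using z(2) f_le[of z] by (simp add: rhs_def algebra_simps)
  finally show ?thesis .
qed

lemma bdd: "bdd_above ((\<lambda>v. v x) ` subsols)"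
proof (rule bdd_aboveI2)
  fix v assume "v \<in> subsols"
  from subsols_bound[OF this, of x] show "v x \<le> w x + (M - l + real CARD('n) + 6 * \<delta>) / \<delta>"
    using \<delta> by (simp add: field_simps)
qed

lemma perron_upper: "v \<in> subsols \<Longrightarrow> v x \<le> perron x"
  unfolding perron_def by (rule cSUP_upper[OF _ bdd])

lemma perron_approx: "c < perron x \<Longrightarrow> \<exists>v\<in>subsols. c < v x"
  unfolding perron_def using less_cSUP_iff[OF _ bdd] w_in_subsols by blast

lemma perron_bound: "\<delta> * (perron x - w x) \<le> M - l + real CARD('n) + 6 * \<delta>"
proof -
  have "perron x \<le> w x + (M - l + real CARD('n) + 6 * \<delta>) / \<delta>"
    unfolding perron_def
  proof (rule cSUP_least)
    fix v assume "v \<in> subsols"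
    from subsols_bound[OF this, of x] show "v x \<le> w x + (M - l + real CARD('n) + 6 * \<delta>) / \<delta>"
      using \<delta> by (simp add: field_simps)
  qed (use w_in_subsols in blast)
  then show ?thesis using \<delta> by (simp add: field_simps)
qed

lemma perron_Lipschitz: "\<bar>perron x - perron y\<bar> \<le> dist x y"
proof -
  have "perron a \<le> perron b + dist a b" for a b
    unfolding perron_def[of a]
  proof (rule cSUP_least)
    fix v assume v: "v \<in> subsols"
    show "v a \<le> perron b + dist a b"
      using subsols_Lipschitz[OF v, of a b] perron_upper[OF v, of b] by linarith
  qed (use w_in_subsols in blast)
  from this[of x y] this[of y x] show ?thesis by (simp add: dist_commute abs_le_iff)
qed

lemma perron_continuous: "continuous_on UNIV perron"
  by (rule one_Lipschitz_continuous[OF perron_Lipschitz])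

text \<open>The approximating subsolutions are nearly maximal at the single point x; elsewhere they
  are only known to lie below \<open>perron\<close>, which the one-sided stability lemma allows.
  Their varying right-hand sides converge jointly because the family is uniformly Lipschitz.\<close>

lemma perron_subsolution: "viscosity_subsolution (op_infty (rhs perron) l) perron"
  unfolding viscosity_subsolution_def
proof (intro conjI ballI allI impI)
  show "usc perron" by (rule continuous_imp_usc[OF perron_continuous])
next
  fix \<phi> x assume \<phi>: "\<phi> \<in> C2_functions" "\<forall>\<^sub>F y in nhds x. perron y - \<phi> y \<le> perron x - \<phi> x"
  have "\<exists>v. v \<in> subsols \<and> perron x - inverse (real (Suc n)) < v x" for n
    using perron_approx[of "perron x - inverse (real (Suc n))" x] by auto
  then obtain v where v: "\<And>n. v n \<in> subsols" "\<And>n. perron x - inverse (real (Suc n)) < v n x"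
    by metis
  have lim: "(\<lambda>n. v n x) \<longlonglongrightarrow> perron x"
  proof (rule tendsto_sandwich)
    have "(\<lambda>n. perron x - inverse (real (Suc n))) \<longlonglongrightarrow> perron x - 0"
      by (intro tendsto_intros LIMSEQ_inverse_real_of_nat)
    then show "(\<lambda>n. perron x - inverse (real (Suc n))) \<longlonglongrightarrow> perron x" by simp
    show "\<forall>\<^sub>F n in sequentially. perron x - inverse (real (Suc n)) \<le> v n x"
      using v(2) by (intro always_eventually allI less_imp_le)
    show "\<forall>\<^sub>F n in sequentially. v n x \<le> perron x" using perron_upper[OF v(1)] by simp
  qed simp
  have joint: "((\<lambda>(n, y). rhs (v n) y) \<longlongrightarrow> rhs perron x) (sequentially \<times>\<^sub>F nhds x)"
  proof -
    have 1: "((\<lambda>z. v (fst z) x) \<longlongrightarrow> perron x) (sequentially \<times>\<^sub>F nhds x)"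
      by (rule filterlim_compose[OF lim filterlim_fst])
    have "((\<lambda>z. dist (snd z) x) \<longlongrightarrow> dist x x) (sequentially \<times>\<^sub>F nhds x)"
      by (rule tendsto_snd_nhds) (intro continuous_intros)
    then have 0: "((\<lambda>z. dist (snd z) x) \<longlongrightarrow> 0) (sequentially \<times>\<^sub>F nhds x)" by simp
    have 2: "((\<lambda>z. v (fst z) (snd z) - v (fst z) x) \<longlongrightarrow> 0) (sequentially \<times>\<^sub>F nhds x)"
      by (rule Lim_null_comparison[OF _ 0]) (use subsols_Lipschitz[OF v(1)] in simp)
    have 3: "((\<lambda>z. v (fst z) (snd z)) \<longlongrightarrow> perron x) (sequentially \<times>\<^sub>F nhds x)"
      using tendsto_add[OF 1 2] by simp
    show ?thesis
      unfolding rhs_def split_def by (intro tendsto_intros tendsto_snd_nhds f w 3)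
  qed
  show "op_infty (rhs perron) l x (grad \<phi> x) (hess \<phi> x) \<le> 0"
  proof (rule op_infty_subsolution_limit[where G=sequentially and g="rhs perron" and w=v and f="\<lambda>n. rhs (v n)" and l="\<lambda>_. l" and k=l and u=perron, OF _ \<phi> _ lim _ joint tendsto_const])
    show "\<forall>\<^sub>F n in sequentially. continuous_on UNIV (v n) \<and> viscosity_subsolution (op_infty (rhs (v n)) l) (v n)"
      using v(1) by (simp add: subsols_def)
    show "\<forall>\<^sub>F n in sequentially. \<forall>y\<in>K. v n y < perron y + \<epsilon>" if "0 < \<epsilon>" for K \<epsilon>
      using that by (intro always_eventually allI ballI le_less_trans[OF perron_upper[OF v(1)]]) simp
  qed simp
qed

text \<open>If the supersolution property failed at \<open>x\<close>, the test function could be lifted slightly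
  above the maximal subsolution near \<open>x\<close>, producing a larger subsolution.\<close>

lemma perron_supersolution: "viscosity_supersolution (op_infty (rhs perron) l) perron"
  unfolding viscosity_supersolution_def
proof (intro conjI ballI allI impI)
  show "lsc perron" by (rule continuous_imp_lsc[OF perron_continuous])
next
  fix \<phi> x assume \<phi>: "\<phi> \<in> C2_functions" "\<forall>\<^sub>F y in nhds x. perron x - \<phi> x \<le> perron y - \<phi> y"
  show "0 \<le> op_infty (rhs perron) l x (grad \<phi> x) (hess \<phi> x)"
  proof (rule ccontr)
    assume neg: "\<not> ?thesis"
    note minus = C2_uminus[OF \<phi>(1)]
    \<comment> \<open>Negating, adding the quartic and negating again makes \<psi> equal to \<phi>
      minus |y - x|^4, which touches strictly from below with the same gradient and Laplacian at
      x.\<close>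
    define \<theta> where "\<theta> = (\<lambda>y. - \<phi> y + radial_quartic x 0 1 0 y)"
    note st = C2_strict_touching[OF minus(1), of x, folded \<theta>_def]
    define \<psi> where "\<psi> = (\<lambda>y. - \<theta> y)"
    note st' = C2_uminus[OF st(1), folded \<psi>_def]
    have \<psi>: "\<psi> \<in> C2_functions" "grad \<psi> x = grad \<phi> x" "trace (hess \<psi> x) = trace (hess \<phi> x)"
      using st' st(2,3) minus(2,3) by (simp_all add: trace_uminus)
    have \<psi>_eq: "\<psi> y = \<phi> y - dist x y ^ 4" for y
      by (simp add: \<psi>_def \<theta>_def radial_quartic_dist)
    \<comment> \<open>The operator along \<psi>, with the discount computed from the vertical shift
      of \<psi> that meets \<open>perron\<close> at x.\<close>
    define h where "h y = max (l - trace (hess \<psi> y) - (f y - \<delta> * (\<psi> y - \<phi> x + perron x - w y)))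
      (norm (grad \<psi> y) - 1)" for y
    have "continuous_on UNIV h"
      unfolding h_def
      by (intro continuous_intros f w C2_hess_continuous C2_grad_continuous C2_continuous \<psi>)
    moreover have hx: "h x < 0"
      using neg \<psi>(2,3) by (simp add: h_def op_infty_def rhs_def \<psi>_eq not_le)
    ultimately have "\<forall>\<^sub>F y in nhds x. h y < h x / 2"
      by (intro order_tendstoD(2)[OF tendsto_nhds_of_continuous]) auto
    then have "\<forall>\<^sub>F y in nhds x. h y < h x / 2 \<and> perron x - \<phi> x \<le> perron y - \<phi> y"
      using \<phi>(2) by (rule eventually_conj)
    then obtain r where r: "r > 0" "\<And>y. dist y x < r \<Longrightarrow> h y < h x / 2 \<and> perron x - \<phi> x \<le> perron y - \<phi> y"
      unfolding eventually_nhds_metric by blast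
    \<comment> \<open>\<kappa> is the height of the lift. The first bound keeps the additional
      discount within half of \<open>- h x\<close>; the second puts the lifted function below
      \<open>perron\<close> beyond distance r / 2, so that W is continuous across the edge of the
      ball.\<close>
    define \<kappa> where "\<kappa> = min (- h x / (2 * \<delta>)) ((r / 2) ^ 4)"
    have \<kappa>: "\<kappa> > 0" "\<kappa> \<le> (r / 2) ^ 4" using hx \<delta> r(1) by (auto simp: \<kappa>_def field_simps)
    have "\<delta> * \<kappa> \<le> \<delta> * (- h x / (2 * \<delta>))" using \<delta> by (intro mult_left_mono) (auto simp: \<kappa>_def)
    then have \<delta>\<kappa>: "\<delta> * \<kappa> \<le> - h x / 2" using \<delta> by simp
    define c where "c = perron x - \<phi> x + \<kappa>"
    define W where "W y = (if y \<in> ball x r then max (perron y) (\<psi> y + c) else perron y)" for y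
    have W_ge: "perron y \<le> W y" for y by (simp add: W_def)
    have W_outer: "W y = perron y" if "dist x y > r / 2" for y
    proof (cases "y \<in> ball x r")
      case True
      have "(r / 2) ^ 4 \<le> dist x y ^ 4" using that r(1) by (intro power_mono) auto
      then have "\<psi> y + c \<le> perron y"
        using r(2)[of y] True \<kappa>(2) by (simp add: \<psi>_eq c_def dist_commute)
      then show ?thesis by (simp add: W_def)
    qed (simp add: W_def)
    have W_cont: "continuous_on UNIV W"
    proof -
      have "continuous_on (ball x r) W"
      proof (rule continuous_on_eq)
        show "continuous_on (ball x r) (\<lambda>y. max (perron y) (\<psi> y + c))"
          by (intro continuous_intros continuous_on_subset[OF perron_continuous]
              continuous_on_subset[OF C2_continuous[OF \<psi>(1)]]) auto
      qed (simp add: W_def)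
      moreover have "continuous_on (- cball x (r / 2)) W"
        by (rule continuous_on_eq[OF continuous_on_subset[OF perron_continuous]]) (auto simp: W_outer)
      ultimately have "continuous_on (ball x r \<union> - cball x (r / 2)) W"
        by (intro continuous_on_open_Un) auto
      moreover have "ball x r \<union> - cball x (r / 2) = UNIV" using r(1) by auto
      ultimately show ?thesis by simp
    qed
    have "viscosity_subsolution (op_infty (rhs W) l) W"
      unfolding viscosity_subsolution_def
    proof (intro conjI ballI allI impI)
      show "usc W" by (rule continuous_imp_usc[OF W_cont])
    next
      fix \<eta> y assume \<eta>: "\<eta> \<in> C2_functions" "\<forall>\<^sub>F z in nhds y. W z - \<eta> z \<le> W y - \<eta> y"
      show "op_infty (rhs W) l y (grad \<eta> y) (hess \<eta> y) \<le> 0"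
      proof (cases "W y = perron y")
        case True
        have "\<forall>\<^sub>F z in nhds y. perron z - \<eta> z \<le> perron y - \<eta> y"
          using \<eta>(2)
        proof eventually_elim
          case (elim z)
          then show ?case using W_ge[of z] True by linarith
        qed
        from viscosity_subsolutionD[OF perron_subsolution \<eta>(1) this] show ?thesis
          by (simp add: op_infty_def rhs_def True)
      next
        case False
        then have y: "y \<in> ball x r" "W y = \<psi> y + c" by (auto simp: W_def max_def split: if_splits)
        have "\<forall>\<^sub>F z in nhds y. z \<in> ball x r" using y(1) by (intro eventually_nhds_in_open) auto
        with \<eta>(2) have "\<forall>\<^sub>F z in nhds y. \<psi> z - \<eta> z \<le> \<psi> y - \<eta> y"
        proof eventually_elim
          case (elim z)
          have "\<psi> z + c \<le> W z" using elim(2) by (simp add: W_def)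
          then show ?case using elim(1) y(2) by linarith
        qed
        \<comment> \<open>Both functions are smooth here, so the classical conditions at a maximum
          compare their gradients and Laplacians; the margin left in \<open>h\<close> absorbs the
          extra discount.\<close>
        from C2_local_max[OF C2_diff(1)[OF \<psi>(1) \<eta>(1)] this]
        have "grad \<eta> y = grad \<psi> y" "trace (hess \<psi> y) \<le> trace (hess \<eta> y)"
          by (simp_all add: C2_diff[OF \<psi>(1) \<eta>(1)] trace_diff)
        moreover have "h y + \<delta> * \<kappa> \<le> 0" "\<delta> * \<kappa> \<ge> 0"
          using r(2)[of y] y(1) \<delta>\<kappa> \<delta> \<kappa>(1) by (simp_all add: dist_commute)
        moreover have "l - trace (hess \<psi> y) - rhs W y \<le> h y + \<delta> * \<kappa>" "norm (grad \<psi> y) - 1 \<le> h y"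
          by (auto simp: rhs_def h_def y(2) c_def algebra_simps)
        ultimately show ?thesis unfolding op_infty_def by simp
      qed
    qed
    then have "W \<in> subsols" using W_cont by (simp add: subsols_def)
    then have "W x \<le> perron x" by (rule perron_upper)
    moreover have "W x \<ge> \<psi> x + c" using r(1) by (simp add: W_def)
    ultimately show False using \<kappa>(1) by (simp add: \<psi>_eq c_def)
  qed
qed

end

section \<open>Finiteness of the limit eigenvalue, convergence and existence\<close>

lemma C0_bounded:
  fixes f :: "real^'n \<Rightarrow> real"
  assumes "f \<in> C0_space"
  obtains K where "K \<ge> 0" "\<And>x. \<bar>f x\<bar> \<le> K"
proof -
  have f: "continuous_on UNIV f" "(f \<longlongrightarrow> 0) at_infinity" using assms by (auto simp: C0_space_def)
  have "\<forall>\<^sub>F x in at_infinity. \<bar>f x\<bar> < 1"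
    using tendstoD[OF f(2), of 1] by (simp add: dist_real_def)
  then obtain b where b: "\<And>x. b \<le> norm x \<Longrightarrow> \<bar>f x\<bar> < 1" unfolding eventually_at_infinity by blast
  have "bounded (f ` cball 0 b)"
    by (intro compact_imp_bounded compact_continuous_image continuous_on_subset[OF f(1)]) auto
  then obtain B where B: "\<forall>y\<in>f ` cball 0 b. \<bar>y\<bar> \<le> B" unfolding bounded_iff by auto
  have "\<bar>f x\<bar> \<le> max 1 B" for x
    using b[of x] B by (cases "b \<le> norm x") (force simp: le_max_iff_disj)+
  then show ?thesis using that[of "max 1 B"] by simp
qed

lemma zero_subsolution:
  assumes "\<And>x. l \<le> f x"
  shows "viscosity_subsolution (op_infty f l) (\<lambda>x::real^'n. 0)"
  unfolding viscosity_subsolution_def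
proof (intro conjI ballI allI impI)
  show "usc (\<lambda>x::real^'n. 0)" by (intro continuous_imp_usc continuous_intros)
next
  fix \<phi> and x :: "real^'n" assume \<phi>: "\<phi> \<in> C2_functions" "\<forall>\<^sub>F y in nhds x. 0 - \<phi> y \<le> 0 - \<phi> x"
  have "\<forall>\<^sub>F y in nhds x. - \<phi> y \<le> - \<phi> x" using \<phi>(2) by simp
  from C2_local_max[OF C2_uminus(1)[OF \<phi>(1)] this]
  show "op_infty f l x (grad \<phi> x) (hess \<phi> x) \<le> 0"
    using assms[of x] by (simp add: C2_uminus[OF \<phi>(1)] trace_uminus op_infty_def)
qed

lemma loc_Holder_1_continuous: "u \<in> loc_Holder 1 \<Longrightarrow> continuous_on UNIV (u :: real^'n \<Rightarrow> real)"
  by (rule loc_Holder_continuous[OF _ zero_less_one])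

lemma lambda_infty_finite:
  fixes f :: "real^'n \<Rightarrow> real"
  assumes "f \<in> C0_space"
  obtains l where "lambda_infty f = ereal l"
proof -
  obtain K where K: "\<And>x. \<bar>f x\<bar> \<le> K" using C0_bounded[OF assms] by blast
  have "lambda_infty f \<le> ereal (K + real CARD('n))"
    unfolding lambda_infty_def
  proof (rule Sup_least, clarify)
    fix l u assume u: "u \<in> loc_Holder 1" "viscosity_subsolution (op_infty f l) u"
    obtain z where "l - real CARD('n) \<le> f z"
      using subsolution_infty_contact[OF loc_Holder_1_continuous[OF u(1)] u(2)] by blast
    then show "ereal l \<le> ereal (K + real CARD('n))" using K[of z] by (simp add: abs_le_iff)
  qed
  moreover have "ereal (- K) \<le> lambda_infty f"
    unfolding lambda_infty_def
  proof (rule Sup_upper, rule imageI, rule CollectI, rule bexI)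
    show "(0::real) = 0 \<and> viscosity_subsolution (op_infty f (- K)) (\<lambda>x. 0)"
      using K by (intro conjI zero_subsolution) (auto simp: abs_le_iff minus_le_iff)
    show "(\<lambda>x. 0) \<in> loc_Holder 1" by (rule one_Lipschitz_loc_Holder) simp
  qed
  ultimately show ?thesis using that by (cases "lambda_infty f") auto
qed

lemma lambda_m_tendsto:
  fixes f :: "real^'n \<Rightarrow> real"
  assumes "f \<in> C0_space" and l: "lambda_infty f = ereal l"
  shows "((\<lambda>m. lambda_m m f) \<longlongrightarrow> ereal l) at_top"
proof (rule order_tendstoI)
  fix a assume "a < ereal l"
  have "((\<lambda>m. ereal l - ereal (1 / m)) \<longlongrightarrow> ereal (l - 0)) at_top"
    unfolding ereal_minus(1) by (intro tendsto_intros tendsto_divide_0[OF tendsto_const] filterlim_at_top_imp_at_infinity filterlim_ident)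
  then have "\<forall>\<^sub>F m::real in at_top. a < ereal l - ereal (1 / m)"
    using \<open>a < ereal l\<close> by (intro order_tendstoD) auto
  then show "\<forall>\<^sub>F m in at_top. a < lambda_m m f"
    using eventually_gt_at_top[of 2]
  proof eventually_elim
    case (elim m)
    have "ereal l \<le> lambda_m m f + ereal (1 / m)" using lambda_infty_le_lambda_m[of m f] elim l by simp
    then have "ereal l - ereal (1 / m) \<le> lambda_m m f" by (subst ereal_minus_le) auto
    then show ?case using elim by (metis less_le_trans)
  qed
next
  fix a assume "ereal l < a"
  then obtain b where b: "ereal l < ereal b" "ereal b < a"
    by (metis ereal_dense2 less_ereal.simps(1))
  show "\<forall>\<^sub>F m in at_top. lambda_m m f < a"
  proof (rule ccontr)
    assume "\<not> ?thesis"
    then have "\<exists>\<^sub>F m in at_top. \<not> lambda_m m f < a" by (simp add: not_eventually)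
    then have fr: "\<exists>\<^sub>F m in at_top. \<exists>u\<in>loc_Holder ((m - 2) / (m - 1)). u 0 = 0 \<and>
      viscosity_subsolution (op_m m f b) u"
    proof (rule frequently_mono[rotated], intro allI impI)
      fix m assume "\<not> lambda_m m f < a"
      with b(2) have "ereal b < lambda_m m f" by (metis less_le_trans not_less)
      then obtain l' u where lu: "b < l'" "u \<in> loc_Holder ((m - 2) / (m - 1))" "u 0 = 0"
          "viscosity_subsolution (op_m m f l') u"
        unfolding lambda_m_def less_Sup_iff by auto
      \<comment> \<open>Lowering l preserves subsolutions, so all these m share the one level
        b.\<close>
      have "viscosity_subsolution (op_m m f b) u"
        using lu(1,4) unfolding viscosity_subsolution_def op_m_def by (force intro: order_trans[rotated])
      with lu show "\<exists>u\<in>loc_Holder ((m - 2) / (m - 1)). u 0 = 0 \<and> viscosity_subsolution (op_m m f b) u"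
        by blast
    qed
    obtain K where K: "\<And>x. \<bar>f x\<bar> \<le> K" using C0_bounded[OF assms(1)] by blast
    have "\<exists>u\<in>loc_Holder 1. u 0 = 0 \<and> viscosity_subsolution (op_infty f b) u"
    proof (rule subsolution_m_limit[OF _ _ fr])
      show "continuous_on UNIV f" using assms(1) by (simp add: C0_space_def)
      show "f x \<le> K" for x using K[of x] by simp
    qed
    then have "ereal b \<le> lambda_infty f" unfolding lambda_infty_def by (intro Sup_upper) blast
    then show False using b(1) l by simp
  qed
qed

lemma solution_at_lambda_infty:
  fixes f :: "real^'n \<Rightarrow> real"
  assumes C0: "f \<in> C0_space" and l: "lambda_infty f = ereal l"
  shows "\<exists>u\<in>loc_Holder 1. u 0 = 0 \<and> viscosity_solution (op_infty f l) u"
proof -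
  have f: "continuous_on UNIV f" using C0 by (simp add: C0_space_def)
  obtain K where K: "\<And>x. \<bar>f x\<bar> \<le> K" using C0_bounded[OF C0] by blast
  then have f_le: "f x \<le> K" for x using abs_le_iff by blast
  define \<delta> where "\<delta> n = inverse (real (Suc n))" for n
  have \<delta>: "0 < \<delta> n" "\<delta> n \<le> 1" for n by (simp_all add: \<delta>_def inverse_le_1_iff)
  have \<delta>0: "\<delta> \<longlonglongrightarrow> 0" unfolding \<delta>_def by (rule LIMSEQ_inverse_real_of_nat)
  have le_l: "k \<le> l" if "u \<in> loc_Holder 1" "u 0 = 0" "viscosity_subsolution (op_infty f k) u" for k u
  proof -
    have "ereal k \<le> lambda_infty f" unfolding lambda_infty_def using that by (intro Sup_upper) blast
    then show ?thesis by (simp add: l)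
  qed
  \<comment> \<open>The supremum is not yet known to be attained, so levels slightly below l are
    used.\<close>
  have "\<exists>k w. l - \<delta> n < k \<and> k \<le> l \<and> continuous_on UNIV w \<and> viscosity_subsolution (op_infty f k) w" for n
  proof -
    have "ereal (l - \<delta> n) < lambda_infty f" using \<delta>(1)[of n] by (simp add: l)
    then obtain k u where "l - \<delta> n < k" "u \<in> loc_Holder 1" "u 0 = 0" "viscosity_subsolution (op_infty f k) u"
      unfolding lambda_infty_def less_Sup_iff by auto
    then show ?thesis using le_l loc_Holder_1_continuous by blast
  qed
  then obtain k w where k: "\<And>n. l - \<delta> n < k n" "\<And>n. k n \<le> l"
    and w: "\<And>n. continuous_on UNIV (w n)" "\<And>n. viscosity_subsolution (op_infty f (k n)) (w n)"
    by metis
  have dp: "discounted_problem f (w n) (k n) (\<delta> n) K" for n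
    by unfold_locales (use f f_le w \<delta> in auto)
  define v where "v n = discounted_problem.perron f (w n) (k n) (\<delta> n)" for n
  define fd where "fd n = discounted_problem.rhs f (w n) (\<delta> n) (v n)" for n
  have fd: "fd n x = f x - \<delta> n * (v n x - w n x)" for n x
    unfolding fd_def by (rule discounted_problem.rhs_def[OF dp])
  have v_lip: "\<bar>v n x - v n y\<bar> \<le> dist x y" for n x y
    unfolding v_def by (rule discounted_problem.perron_Lipschitz[OF dp])
  have w_lip: "\<bar>w n x - w n y\<bar> \<le> dist x y" for n x y
    by (rule subsolution_infty_1_Lipschitz[OF w])
  have v_sol: "viscosity_solution (op_infty (fd n) (k n)) (v n)" for n
    unfolding viscosity_solution_def v_def fd_def
    using discounted_problem.perron_subsolution[OF dp] discounted_problem.perron_supersolution[OF dp] by blast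
  \<comment> \<open>The discount of the n-th solution at the origin; its limit is the amount by
    which the level l would rise.\<close>
  define c where "c n = \<delta> n * (v n 0 - w n 0)" for n
  have c: "0 \<le> c n" "c n \<le> K - l + real CARD('n) + 7" for n
  proof -
    have "w n 0 \<le> v n 0" unfolding v_def
      by (rule discounted_problem.perron_upper[OF dp discounted_problem.w_in_subsols[OF dp]])
    then show "0 \<le> c n" using \<delta>(1)[of n] by (simp add: c_def)
    have "c n \<le> K - k n + real CARD('n) + 6 * \<delta> n"
      unfolding c_def v_def by (rule discounted_problem.perron_bound[OF dp])
    \<comment> \<open>Here 7 = 6 + 1, since \<open>k n\<close> lies within \<open>\<delta> n\<close>
      of l and \<open>\<delta> n\<close> is at most 1.\<close>
    then show "c n \<le> K - l + real CARD('n) + 7" using k(1)[of n] \<delta>(2)[of n] by linarith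
  qed
  define V where "V n x = v n x - v n 0" for n x
  have V_lip: "\<bar>V n x - V n y\<bar> \<le> dist x y" for n x y using v_lip[of n x y] by (simp add: V_def)
  have V_cont: "continuous_on UNIV (V n)" for n by (rule one_Lipschitz_continuous[OF V_lip])
  have V_sol: "viscosity_solution (op_infty (fd n) (k n)) (V n)" for n
    unfolding V_def by (rule viscosity_solution_diff_const[OF one_Lipschitz_continuous[OF v_lip] v_sol])
  \<comment> \<open>The extra index \<open>None\<close> lets one compactness argument produce the
    limit of the numbers \<open>c n\<close> together with the limits of all values
    \<open>V n x\<close>.\<close>
  define Z where "Z n z = (case z of None \<Rightarrow> c n | Some x \<Rightarrow> V n x)" for n and z :: "(real^'n) option"
  define b where "b z = (case z of None \<Rightarrow> K - l + real CARD('n) + 7 | Some x \<Rightarrow> norm x)"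
    for z :: "(real^'n) option"
  have "\<bar>Z n z\<bar> \<le> b z" for n z
    using c[of n] V_lip[of n _ 0] by (auto simp: Z_def b_def V_def split: option.split)
  then have "\<forall>\<^sub>F n in sequentially. \<forall>z. \<bar>Z n z\<bar> \<le> b z" by simp
  from pointwise_cluster[OF sequentially_bot this]
  obtain G u0 where G: "G \<le> sequentially" "G \<noteq> bot" and lim0: "\<And>z. ((\<lambda>n. Z n z) \<longlongrightarrow> u0 z) G"
    by blast
  define u where "u x = u0 (Some x)" for x
  define c0 where "c0 = u0 None"
  have lim: "((\<lambda>n. V n x) \<longlongrightarrow> u x) G" for x using lim0[of "Some x"] by (simp add: Z_def u_def)
  have lim_c: "(c \<longlongrightarrow> c0) G" using lim0[of None] by (simp add: Z_def c0_def)
  have lim_\<delta>: "(\<delta> \<longlongrightarrow> 0) G" using \<delta>0 G(1) by (rule tendsto_mono[rotated])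
  have lim_k: "(k \<longlongrightarrow> l) G"
  proof (rule tendsto_sandwich)
    show "((\<lambda>n. l - \<delta> n) \<longlongrightarrow> l) G" using tendsto_diff[OF tendsto_const lim_\<delta>, of l] by simp
    show "\<forall>\<^sub>F n in G. l - \<delta> n \<le> k n" using k(1) by (intro always_eventually allI less_imp_le)
    show "\<forall>\<^sub>F n in G. k n \<le> l" using k(2) by simp
  qed simp
  interpret equicontinuous_family G V u
  proof
    show "\<exists>d>0. \<forall>\<^sub>F n in G. \<forall>x y. dist x y < d \<longrightarrow> \<bar>V n x - V n y\<bar> \<le> \<epsilon>" if "\<epsilon> > 0" for \<epsilon>
      using that order_trans[OF V_lip less_imp_le] by (intro exI[of _ \<epsilon>]) simp
  qed (rule G lim)+
  \<comment> \<open>The discount at y is \<open>c n\<close> plus \<open>\<delta> n\<close> times the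
    change of \<open>v n - w n\<close> from 0 to y. That change is at most 2|y|, so only the
    constant \<open>c0\<close> survives.\<close>
  have joint: "((\<lambda>(n, y). fd n y) \<longlongrightarrow> f x - c0) (G \<times>\<^sub>F nhds x)" for x
  proof -
    have 1: "((\<lambda>z. c (fst z)) \<longlongrightarrow> c0) (G \<times>\<^sub>F nhds x)"
      by (rule filterlim_compose[OF lim_c filterlim_fst])
    have "((\<lambda>z. \<delta> (fst z) * (2 * norm (snd z))) \<longlongrightarrow> 0 * (2 * norm x)) (G \<times>\<^sub>F nhds x)"
      by (intro tendsto_mult filterlim_compose[OF lim_\<delta> filterlim_fst] tendsto_const tendsto_snd_nhds continuous_intros)
    then have 0: "((\<lambda>z. \<delta> (fst z) * (2 * norm (snd z))) \<longlongrightarrow> 0) (G \<times>\<^sub>F nhds x)" by simp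
    have 2: "((\<lambda>z. \<delta> (fst z) * (V (fst z) (snd z) - (w (fst z) (snd z) - w (fst z) 0))) \<longlongrightarrow> 0) (G \<times>\<^sub>F nhds x)"
    proof (rule Lim_null_comparison[OF always_eventually[OF allI] 0])
      fix z :: "nat \<times> (real^'n)"
      have "\<bar>V (fst z) (snd z) - (w (fst z) (snd z) - w (fst z) 0)\<bar> \<le> 2 * norm (snd z)"
        using v_lip[of "fst z" "snd z" 0] w_lip[of "fst z" "snd z" 0] by (simp add: V_def)
      then show "norm (\<delta> (fst z) * (V (fst z) (snd z) - (w (fst z) (snd z) - w (fst z) 0)))
          \<le> \<delta> (fst z) * (2 * norm (snd z))"
        using \<delta>(1)[of "fst z"] by (simp add: abs_mult)
    qed
    have "((\<lambda>z. f (snd z) - c (fst z) - \<delta> (fst z) * (V (fst z) (snd z) - (w (fst z) (snd z) - w (fst z) 0)))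
        \<longlongrightarrow> f x - c0 - 0) (G \<times>\<^sub>F nhds x)"
      by (intro tendsto_diff tendsto_snd_nhds f 1 2)
    moreover have "f (snd z) - c (fst z) - \<delta> (fst z) * (V (fst z) (snd z) - (w (fst z) (snd z) - w (fst z) 0))
        = (case z of (n, y) \<Rightarrow> fd n y)" for z
      by (simp add: fd c_def V_def split_def algebra_simps)
    ultimately show ?thesis by simp
  qed
  have "viscosity_subsolution (op_infty (\<lambda>x. f x - c0) l) u"
    unfolding viscosity_subsolution_def
  proof (intro conjI ballI allI impI)
    show "usc u" by (rule continuous_imp_usc[OF continuous_limit])
  next
    fix \<phi> x assume \<phi>: "\<phi> \<in> C2_functions" "\<forall>\<^sub>F y in nhds x. u y - \<phi> y \<le> u x - \<phi> x"
    show "op_infty (\<lambda>x. f x - c0) l x (grad \<phi> x) (hess \<phi> x) \<le> 0"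
    proof (rule op_infty_subsolution_limit[where G=G and w=V and f=fd and l=k and u=u and g="\<lambda>x. f x - c0", OF _ \<phi> _ lim _ joint lim_k])
      show "\<forall>\<^sub>F n in G. continuous_on UNIV (V n) \<and> viscosity_subsolution (op_infty (fd n) (k n)) (V n)"
        using V_cont V_sol by (simp add: viscosity_solution_def)
      show "\<forall>\<^sub>F n in G. \<forall>y\<in>K. V n y < u y + \<epsilon>" if "compact K" "0 < \<epsilon>" for K \<epsilon>
        using uniform_on_compact[OF that] by eventually_elim (auto simp: abs_less_iff algebra_simps)
    qed (rule nonbot)
  qed
  moreover have "viscosity_supersolution (op_infty (\<lambda>x. f x - c0) l) u"
    unfolding viscosity_supersolution_def
  proof (intro conjI ballI allI impI)
    show "lsc u" by (rule continuous_imp_lsc[OF continuous_limit])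
  next
    fix \<phi> x assume \<phi>: "\<phi> \<in> C2_functions" "\<forall>\<^sub>F y in nhds x. u x - \<phi> x \<le> u y - \<phi> y"
    show "0 \<le> op_infty (\<lambda>x. f x - c0) l x (grad \<phi> x) (hess \<phi> x)"
    proof (rule op_infty_supersolution_limit[where G=G and w=V and f=fd and l=k and u=u and g="\<lambda>x. f x - c0", OF _ \<phi> _ lim _ joint lim_k])
      show "\<forall>\<^sub>F n in G. continuous_on UNIV (V n) \<and> viscosity_supersolution (op_infty (fd n) (k n)) (V n)"
        using V_cont V_sol by (simp add: viscosity_solution_def)
      show "\<forall>\<^sub>F n in G. \<forall>y\<in>K. u y - \<epsilon> < V n y" if "compact K" "0 < \<epsilon>" for K \<epsilon>
        using uniform_on_compact[OF that] by eventually_elim (auto simp: abs_less_iff algebra_simps)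
    qed (rule nonbot)
  qed
  \<comment> \<open>A constant subtracted from f is the same as a constant added to the
    level.\<close>
  ultimately have sol: "viscosity_solution (op_infty f (l + c0)) u"
    unfolding op_infty_shift viscosity_solution_def by simp
  have u_H: "u \<in> loc_Holder 1"
    using sol unfolding viscosity_solution_def
    by (intro one_Lipschitz_loc_Holder subsolution_infty_1_Lipschitz[OF continuous_limit]) blast
  have "((\<lambda>n. V n 0) \<longlongrightarrow> 0) G" by (simp add: V_def)
  then have u0: "u 0 = 0" using tendsto_unique[OF nonbot lim[of 0]] by blast
  have "c0 \<ge> 0" by (rule tendsto_lowerbound[OF lim_c _ nonbot]) (simp add: c)
  moreover have "l + c0 \<le> l"
    using sol by (intro le_l[OF u_H u0]) (simp add: viscosity_solution_def)
  ultimately have "c0 = 0" by simp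
  then show ?thesis using sol u_H u0 by auto
qed

theorem theorem3p2:
  fixes f :: "real^'n \<Rightarrow> real"
  assumes "f \<in> C0_space"
  shows "\<exists>l :: real. lambda_infty f = ereal l \<and>
           ((\<lambda>m. lambda_m m f) \<longlongrightarrow> ereal l) at_top \<and>
           (\<exists>u \<in> loc_Holder 1. u 0 = 0 \<and> viscosity_solution (op_infty f l) u)"
proof -
  obtain l where l: "lambda_infty f = ereal l" by (rule lambda_infty_finite[OF assms])
  show ?thesis
    using l lambda_m_tendsto[OF assms l] solution_at_lambda_infty[OF assms l] by blast
qed

end
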